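(* Let $\mathcal{D}_1,\mathcal{D}_2$ be triangulated categories, let $(\mathcal{U}_1,\dots,\mathcal{U}_n)$ be an $n$-gon of recollements in $\mathcal{D}_1$ and let $(\mathcal{V}_1,\dots,\mathcal{V}_n)$ be an $n$-gon of recollements in $\mathcal{D}_2$. Let $F:\mathcal{D}_1\to\mathcal{D}_2$ be a triangle functor which sends $(\mathcal{U}_1,\dots,\mathcal{U}_n)$ to $(\mathcal{V}_1,\dots,\mathcal{V}_n)$. Then the following hold. (1) If $n$ is odd and $F|_{\mathcal{U}_t}:\mathcal{U}_t\to\mathcal{V}_t$ is fully faithful (resp. an equivalence) for some $t$, then $F$ is fully faithful (resp. an equivalence). (2) If $n$ is even and both $F|_{\mathcal{U}_t}:\mathcal{U}_t\to\mathcal{V}_t$ and $F|_{\mathcal{U}_{t+1}}:\mathcal{U}_{t+1}\to\mathcal{V}_{t+1}$ are fully faithful (resp. equivalences) for some $t$, then $F$ is fully faithful (resp. an equivalence).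
   Context: Let $\mathcal{D}$ be a triangulated category with translation functor $\Sigma$. A pair $(\mathcal{U},\mathcal{V})$ of full subcategories of $\mathcal{D}$ is a stable t-structure in $\mathcal{D}$ if (a) $\mathcal{U}=\Sigma\mathcal{U}$ and $\mathcal{V}=\Sigma\mathcal{V}$; (b) $\operatorname{Hom}_{\mathcal{D}}(\mathcal{U},\mathcal{V})=0$; (c) for every $X\in\mathcal{D}$ there is a triangle $U\to X\to V\to\Sigma U$ with $U\in\mathcal{U}$ and $V\in\mathcal{V}$. An $n$-tuple $(\mathcal{U}_1,\dots,\mathcal{U}_n)$ of full triangulated subcategories of $\mathcal{D}$ is an $n$-gon of recollements in $\mathcal{D}$ if $(\mathcal{U}_i,\mathcal{U}_{i+1})$ is a stable t-structure in $\mathcal{D}$ for $1\le i\le n$, where $\mathcal{U}_{n+1}=\mathcal{U}_1$ (indices are read modulo $n$). A triangle functor $F:\mathcal{D}_1\to\mathcal{D}_2$ sends an $n$-gon $(\mathcal{U}_1,\dots,\mathcal{U}_n)$ in $\mathcal{D}_1$ to an $n$-gon $(\mathcal{V}_1,\dots,\mathcal{V}_n)$ in $\mathcal{D}_2$ if $F(\mathcal{U}_k)$ is contained in $\mathcal{V}_k$ for every $k$. *)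

theory Defs
  imports "HOL-Algebra.Group"
begin

text \<open>
  Categories are records of a set of objects and a set of arrows with explicit domain and
  codomain, so that distinct hom-sets are disjoint; the operations are meaningful only on the
  carriers. \<open>g \<odot> f\<close> is the composite ``g after f''.
\<close>

record ('o, 'm) cat_data =
  Ob :: "'o set"
  Arr :: "'m set"
  Dom :: "'m \<Rightarrow> 'o"
  Cod :: "'m \<Rightarrow> 'o"
  Ident :: "'o \<Rightarrow> 'm"
  Comp :: "'m \<Rightarrow> 'm \<Rightarrow> 'm"  (infixr "\<odot>\<index>" 70)

definition Hom :: "('o, 'm, 'x) cat_data_scheme \<Rightarrow> 'o \<Rightarrow> 'o \<Rightarrow> 'm set"
  where "Hom C X Y = {f \<in> Arr C. Dom C f = X \<and> Cod C f = Y}"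

locale category =
  fixes C :: "('o, 'm, 'x) cat_data_scheme" (structure)
  assumes dom_closed: "f \<in> Arr C \<Longrightarrow> Dom C f \<in> Ob C"
    and cod_closed: "f \<in> Arr C \<Longrightarrow> Cod C f \<in> Ob C"
    and ident_hom: "X \<in> Ob C \<Longrightarrow> Ident C X \<in> Hom C X X"
    and comp_hom: "f \<in> Hom C X Y \<Longrightarrow> g \<in> Hom C Y Z \<Longrightarrow> g \<odot> f \<in> Hom C X Z"
    and comp_assoc:
      "f \<in> Hom C W X \<Longrightarrow> g \<in> Hom C X Y \<Longrightarrow> h \<in> Hom C Y Z \<Longrightarrow> (h \<odot> g) \<odot> f = h \<odot> (g \<odot> f)"
    and comp_ident_right: "f \<in> Hom C X Y \<Longrightarrow> f \<odot> Ident C X = f"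
    and comp_ident_left: "f \<in> Hom C X Y \<Longrightarrow> Ident C Y \<odot> f = f"

definition iso_arr :: "('o, 'm, 'x) cat_data_scheme \<Rightarrow> 'o \<Rightarrow> 'o \<Rightarrow> 'm \<Rightarrow> bool"
  where "iso_arr C X Y f \<longleftrightarrow> f \<in> Hom C X Y \<and>
    (\<exists>g \<in> Hom C Y X. g \<odot>\<^bsub>C\<^esub> f = Ident C X \<and> f \<odot>\<^bsub>C\<^esub> g = Ident C Y)"

definition iso_objs :: "('o, 'm, 'x) cat_data_scheme \<Rightarrow> 'o \<Rightarrow> 'o \<Rightarrow> bool"
  where "iso_objs C X Y \<longleftrightarrow> (\<exists>f. iso_arr C X Y f)"

definition zero_object :: "('o, 'm, 'x) cat_data_scheme \<Rightarrow> 'o \<Rightarrow> bool"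
  where "zero_object C Z \<longleftrightarrow> Z \<in> Ob C \<and>
    (\<forall>X \<in> Ob C. (\<exists>!f. f \<in> Hom C X Z) \<and> (\<exists>!f. f \<in> Hom C Z X))"

text \<open>A full subcategory is given by its set of objects, a subset of \<open>Ob C\<close>.\<close>

definition full_subcat :: "('o, 'm, 'x) cat_data_scheme \<Rightarrow> 'o set \<Rightarrow> ('o, 'm) cat_data"
  where "full_subcat C U =
    \<lparr>Ob = U, Arr = {f \<in> Arr C. Dom C f \<in> U \<and> Cod C f \<in> U},
     Dom = Dom C, Cod = Cod C, Ident = Ident C, Comp = Comp C\<rparr>"

definition iso_closure :: "('o, 'm, 'x) cat_data_scheme \<Rightarrow> 'o set \<Rightarrow> 'o set"
  where "iso_closure C U = {X \<in> Ob C. \<exists>Y \<in> U. iso_objs C X Y}"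

locale cat_functor =
  C: category C + D: category D
  for C :: "('o1, 'm1, 'x) cat_data_scheme" and D :: "('o2, 'm2, 'y) cat_data_scheme" +
  fixes Fo :: "'o1 \<Rightarrow> 'o2" and Fa :: "'m1 \<Rightarrow> 'm2"
  assumes map_ob: "X \<in> Ob C \<Longrightarrow> Fo X \<in> Ob D"
    and map_hom: "f \<in> Hom C X Y \<Longrightarrow> Fa f \<in> Hom D (Fo X) (Fo Y)"
    and map_ident: "X \<in> Ob C \<Longrightarrow> Fa (Ident C X) = Ident D (Fo X)"
    and map_comp:
      "f \<in> Hom C X Y \<Longrightarrow> g \<in> Hom C Y Z \<Longrightarrow> Fa (g \<odot>\<^bsub>C\<^esub> f) = Fa g \<odot>\<^bsub>D\<^esub> Fa f"

definition natural_iso ::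
  "('o1, 'm1, 'x) cat_data_scheme \<Rightarrow> ('o2, 'm2, 'y) cat_data_scheme \<Rightarrow>
   ('o1 \<Rightarrow> 'o2) \<Rightarrow> ('m1 \<Rightarrow> 'm2) \<Rightarrow> ('o1 \<Rightarrow> 'o2) \<Rightarrow> ('m1 \<Rightarrow> 'm2) \<Rightarrow> ('o1 \<Rightarrow> 'm2) \<Rightarrow> bool"
  where "natural_iso C D Fo Fa Go Ga \<eta> \<longleftrightarrow>
    (\<forall>X \<in> Ob C. iso_arr D (Fo X) (Go X) (\<eta> X)) \<and>
    (\<forall>X \<in> Ob C. \<forall>Y \<in> Ob C. \<forall>f \<in> Hom C X Y. \<eta> Y \<odot>\<^bsub>D\<^esub> Fa f = Ga f \<odot>\<^bsub>D\<^esub> \<eta> X)"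

definition fully_faithful ::
  "('o1, 'm1, 'x) cat_data_scheme \<Rightarrow> ('o2, 'm2, 'y) cat_data_scheme \<Rightarrow>
   ('o1 \<Rightarrow> 'o2) \<Rightarrow> ('m1 \<Rightarrow> 'm2) \<Rightarrow> bool"
  where "fully_faithful C D Fo Fa \<longleftrightarrow> cat_functor C D Fo Fa \<and>
    (\<forall>X \<in> Ob C. \<forall>Y \<in> Ob C. bij_betw Fa (Hom C X Y) (Hom D (Fo X) (Fo Y)))"

definition cat_equivalence ::
  "('o1, 'm1, 'x) cat_data_scheme \<Rightarrow> ('o2, 'm2, 'y) cat_data_scheme \<Rightarrow>
   ('o1 \<Rightarrow> 'o2) \<Rightarrow> ('m1 \<Rightarrow> 'm2) \<Rightarrow> bool"
  where "cat_equivalence C D Fo Fa \<longleftrightarrow> cat_functor C D Fo Fa \<and>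
    (\<exists>Go Ga \<eta> \<epsilon>. cat_functor D C Go Ga \<and>
      natural_iso C C id id (Go \<circ> Fo) (Ga \<circ> Fa) \<eta> \<and>
      natural_iso D D (Fo \<circ> Go) (Fa \<circ> Ga) id id \<epsilon>)"

record ('o, 'm) preadd_data = "('o, 'm) cat_data" +
  HomAdd :: "'m \<Rightarrow> 'm \<Rightarrow> 'm"
  HomZero :: "'o \<Rightarrow> 'o \<Rightarrow> 'm"

definition HomGroup :: "('o, 'm, 'x) preadd_data_scheme \<Rightarrow> 'o \<Rightarrow> 'o \<Rightarrow> 'm monoid"
  where "HomGroup C X Y = \<lparr>carrier = Hom C X Y, mult = HomAdd C, one = HomZero C X Y\<rparr>"

definition HomNeg :: "('o, 'm, 'x) preadd_data_scheme \<Rightarrow> 'm \<Rightarrow> 'm"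
  where "HomNeg C f = inv\<^bsub>HomGroup C (Dom C f) (Cod C f)\<^esub> f"

definition biproduct ::
  "('o, 'm, 'x) preadd_data_scheme \<Rightarrow> 'o \<Rightarrow> 'o \<Rightarrow> 'o \<Rightarrow> 'm \<Rightarrow> 'm \<Rightarrow> 'm \<Rightarrow> 'm \<Rightarrow> bool"
  where "biproduct C X Y B i j p q \<longleftrightarrow> B \<in> Ob C \<and>
    i \<in> Hom C X B \<and> j \<in> Hom C Y B \<and> p \<in> Hom C B X \<and> q \<in> Hom C B Y \<and>
    p \<odot>\<^bsub>C\<^esub> i = Ident C X \<and> q \<odot>\<^bsub>C\<^esub> j = Ident C Y \<and>
    p \<odot>\<^bsub>C\<^esub> j = HomZero C Y X \<and> q \<odot>\<^bsub>C\<^esub> i = HomZero C X Y \<and>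
    HomAdd C (i \<odot>\<^bsub>C\<^esub> p) (j \<odot>\<^bsub>C\<^esub> q) = Ident C B"

locale additive_category = category C
  for C :: "('o, 'm, 'x) preadd_data_scheme" (structure) +
  assumes hom_group: "X \<in> Ob C \<Longrightarrow> Y \<in> Ob C \<Longrightarrow> comm_group (HomGroup C X Y)"
    and comp_add_right:
      "f \<in> Hom C X Y \<Longrightarrow> f' \<in> Hom C X Y \<Longrightarrow> g \<in> Hom C Y Z \<Longrightarrow>
       g \<odot> HomAdd C f f' = HomAdd C (g \<odot> f) (g \<odot> f')"
    and comp_add_left:
      "f \<in> Hom C X Y \<Longrightarrow> g \<in> Hom C Y Z \<Longrightarrow> g' \<in> Hom C Y Z \<Longrightarrow>
       HomAdd C g g' \<odot> f = HomAdd C (g \<odot> f) (g' \<odot> f)"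
    and zero_object_exists: "\<exists>Z. zero_object C Z"
    and biproduct_exists:
      "X \<in> Ob C \<Longrightarrow> Y \<in> Ob C \<Longrightarrow> \<exists>B i j p q. biproduct C X Y B i j p q"

locale additive_functor =
  C: additive_category C + D: additive_category D + cat_functor C D Fo Fa
  for C :: "('o1, 'm1, 'x) preadd_data_scheme" and D :: "('o2, 'm2, 'y) preadd_data_scheme"
    and Fo :: "'o1 \<Rightarrow> 'o2" and Fa :: "'m1 \<Rightarrow> 'm2" +
  assumes map_add:
    "f \<in> Hom C X Y \<Longrightarrow> g \<in> Hom C X Y \<Longrightarrow> Fa (HomAdd C f g) = HomAdd D (Fa f) (Fa g)"

text \<open>
  The translation functor is given by its action \<open>ShiftO\<close> on objects and \<open>ShiftA\<close> on arrows;
  \<open>(f, g, h) \<in> Tri C\<close> says that \<open>f : X \<rightarrow> Y\<close>, \<open>g : Y \<rightarrow> Z\<close>, \<open>h : Z \<rightarrow> \<Sigma> X\<close> is a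
  distinguished triangle.
\<close>

record ('o, 'm) tri_data = "('o, 'm) preadd_data" +
  ShiftO :: "'o \<Rightarrow> 'o"
  ShiftA :: "'m \<Rightarrow> 'm"
  Tri :: "('m \<times> 'm \<times> 'm) set"

definition triangle_shape ::
  "('o, 'm, 'x) tri_data_scheme \<Rightarrow> 'o \<Rightarrow> 'o \<Rightarrow> 'o \<Rightarrow> 'm \<Rightarrow> 'm \<Rightarrow> 'm \<Rightarrow> bool"
  where "triangle_shape C X Y Z f g h \<longleftrightarrow>
    f \<in> Hom C X Y \<and> g \<in> Hom C Y Z \<and> h \<in> Hom C Z (ShiftO C X)"

definition dist_triangle ::
  "('o, 'm, 'x) tri_data_scheme \<Rightarrow> 'o \<Rightarrow> 'o \<Rightarrow> 'o \<Rightarrow> 'm \<Rightarrow> 'm \<Rightarrow> 'm \<Rightarrow> bool"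
  where "dist_triangle C X Y Z f g h \<longleftrightarrow> triangle_shape C X Y Z f g h \<and> (f, g, h) \<in> Tri C"

text \<open>
  Verdier's axioms. The translation is only required to be an autoequivalence, which includes
  the convention that it is an automorphism. The last axiom is the octahedral axiom.
\<close>

locale triangulated_category = additive_category C
  for C :: "('o, 'm, 'x) tri_data_scheme" (structure) +
  assumes shift_additive: "additive_functor C C (ShiftO C) (ShiftA C)"
    and shift_equivalence: "cat_equivalence C C (ShiftO C) (ShiftA C)"
    and tri_shape: "(f, g, h) \<in> Tri C \<Longrightarrow> \<exists>X Y Z. triangle_shape C X Y Z f g h"
    and tri_iso:
      "dist_triangle C X Y Z f g h \<Longrightarrow> triangle_shape C X' Y' Z' f' g' h' \<Longrightarrow>
       iso_arr C X X' a \<Longrightarrow> iso_arr C Y Y' b \<Longrightarrow> iso_arr C Z Z' c \<Longrightarrow>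
       b \<odot> f = f' \<odot> a \<Longrightarrow> c \<odot> g = g' \<odot> b \<Longrightarrow> ShiftA C a \<odot> h = h' \<odot> c \<Longrightarrow>
       dist_triangle C X' Y' Z' f' g' h'"
    and tri_ident:
      "X \<in> Ob C \<Longrightarrow> zero_object C Z \<Longrightarrow>
       dist_triangle C X X Z (Ident C X) (HomZero C X Z) (HomZero C Z (ShiftO C X))"
    and tri_cone: "f \<in> Hom C X Y \<Longrightarrow> \<exists>Z g h. dist_triangle C X Y Z f g h"
    and tri_rotate:
      "triangle_shape C X Y Z f g h \<Longrightarrow>
       dist_triangle C X Y Z f g h \<longleftrightarrow>
       dist_triangle C Y Z (ShiftO C X) g h (HomNeg C (ShiftA C f))"
    and tri_morphism:
      "dist_triangle C X Y Z f g h \<Longrightarrow> dist_triangle C X' Y' Z' f' g' h' \<Longrightarrow>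
       a \<in> Hom C X X' \<Longrightarrow> b \<in> Hom C Y Y' \<Longrightarrow> b \<odot> f = f' \<odot> a \<Longrightarrow>
       \<exists>c \<in> Hom C Z Z'. c \<odot> g = g' \<odot> b \<and> ShiftA C a \<odot> h = h' \<odot> c"
    and tri_octahedral:
      "dist_triangle C X Y Z' f f' f'' \<Longrightarrow> dist_triangle C Y Z X' g g' g'' \<Longrightarrow>
       dist_triangle C X Z Y' (g \<odot> f) h' h'' \<Longrightarrow>
       \<exists>u v. dist_triangle C Z' Y' X' u v (ShiftA C f' \<odot> g'') \<and>
         u \<odot> f' = h' \<odot> g \<and> h'' \<odot> u = f'' \<and>
         v \<odot> h' = g' \<and> g'' \<odot> v = ShiftA C f \<odot> h''"

text \<open>A triangle functor is the pair of a functor \<open>F\<close> and an isomorphism \<open>\<phi> : F \<Sigma> \<rightarrow> \<Sigma> F\<close>.\<close>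

locale triangle_functor =
  C: triangulated_category C + D: triangulated_category D + additive_functor C D Fo Fa
  for C :: "('o1, 'm1, 'x) tri_data_scheme" and D :: "('o2, 'm2, 'y) tri_data_scheme"
    and Fo :: "'o1 \<Rightarrow> 'o2" and Fa :: "'m1 \<Rightarrow> 'm2" +
  fixes \<phi> :: "'o1 \<Rightarrow> 'm2"
  assumes shift_compat:
      "natural_iso C D (Fo \<circ> ShiftO C) (Fa \<circ> ShiftA C) (ShiftO D \<circ> Fo) (ShiftA D \<circ> Fa) \<phi>"
    and map_triangle:
      "dist_triangle C X Y Z f g h \<Longrightarrow>
       dist_triangle D (Fo X) (Fo Y) (Fo Z) (Fa f) (Fa g) (\<phi> X \<odot>\<^bsub>D\<^esub> Fa h)"

text \<open>
  The condition \<open>U = \<Sigma> U\<close> on full subcategories. Subcategories need not be closed under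
  isomorphism, and \<open>\<Sigma>\<close> need not be bijective on objects, so the equality is one of closures
  under isomorphism. If \<open>U\<close> is closed under isomorphism, this says that \<open>U\<close> is the essential
  image of \<open>U\<close> under \<open>\<Sigma>\<close>; it is implied by the equality \<open>U = \<Sigma> ` U\<close> of sets of objects.
\<close>

definition shift_stable :: "('o, 'm, 'x) tri_data_scheme \<Rightarrow> 'o set \<Rightarrow> bool"
  where "shift_stable C U \<longleftrightarrow> iso_closure C U = iso_closure C (ShiftO C ` U)"

definition full_triangulated_subcat :: "('o, 'm, 'x) tri_data_scheme \<Rightarrow> 'o set \<Rightarrow> bool"
  where "full_triangulated_subcat C U \<longleftrightarrow> U \<subseteq> Ob C \<and>
    (\<exists>Z \<in> U. zero_object C Z) \<and> shift_stable C U \<and>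
    (\<forall>X Y Z f g h. dist_triangle C X Y Z f g h \<longrightarrow> X \<in> U \<longrightarrow> Y \<in> U \<longrightarrow> Z \<in> iso_closure C U)"

definition stable_t_structure :: "('o, 'm, 'x) tri_data_scheme \<Rightarrow> 'o set \<Rightarrow> 'o set \<Rightarrow> bool"
  where "stable_t_structure C U V \<longleftrightarrow> U \<subseteq> Ob C \<and> V \<subseteq> Ob C \<and>
    shift_stable C U \<and> shift_stable C V \<and>
    (\<forall>X \<in> U. \<forall>Y \<in> V. Hom C X Y = {HomZero C X Y}) \<and>
    (\<forall>X \<in> Ob C. \<exists>A \<in> U. \<exists>B \<in> V. \<exists>f g h. dist_triangle C A X B f g h)"

text \<open>
  An \<open>n\<close>-tuple is a family restricted to the indices \<open>1, \<dots>, n\<close>; the cyclic successor sends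
  \<open>n\<close> to \<open>1\<close> and every other such \<open>i\<close> to \<open>i + 1\<close>.
\<close>

definition cyclic_succ :: "nat \<Rightarrow> nat \<Rightarrow> nat"
  where "cyclic_succ n i = Suc (i mod n)"

definition ngon_of_recollements ::
  "('o, 'm, 'x) tri_data_scheme \<Rightarrow> nat \<Rightarrow> (nat \<Rightarrow> 'o set) \<Rightarrow> bool"
  where "ngon_of_recollements C n U \<longleftrightarrow>
    (\<forall>i \<in> {1..n}. full_triangulated_subcat C (U i)) \<and>
    (\<forall>i \<in> {1..n}. stable_t_structure C (U i) (U (cyclic_succ n i)))"

definition sends_ngon ::
  "nat \<Rightarrow> ('o1 \<Rightarrow> 'o2) \<Rightarrow> (nat \<Rightarrow> 'o1 set) \<Rightarrow> (nat \<Rightarrow> 'o2 set) \<Rightarrow> bool"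
  where "sends_ngon n Fo U V \<longleftrightarrow> (\<forall>k \<in> {1..n}. Fo ` U k \<subseteq> V k)"

lemma category_full_subcat:
  assumes "category C" "U \<subseteq> Ob C"
  shows "category (full_subcat C U)"
proof -
  interpret category C by fact
  have H: "Hom (full_subcat C U) X Y = (if X \<in> U \<and> Y \<in> U then Hom C X Y else {})" for X Y
    by (auto simp: Hom_def full_subcat_def)
  have F: "Ob (full_subcat C U) = U" "Dom (full_subcat C U) = Dom C"
    "Cod (full_subcat C U) = Cod C" "Ident (full_subcat C U) = Ident C"
    "Comp (full_subcat C U) = Comp C" "\<And>f. f \<in> Arr (full_subcat C U) \<Longrightarrow> Dom C f \<in> U \<and> Cod C f \<in> U"
    by (auto simp: full_subcat_def)
  show ?thesis
    unfolding category_def H F(1-5)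
    using assms(2) F(6)
    by (auto intro: ident_hom comp_hom comp_assoc comp_ident_left comp_ident_right
        split: if_splits)
qed

end

theory Submission
  imports Defs
begin

text \<open>
  In a pair of consecutive stable t-structures \<open>(U, V)\<close>, \<open>(V, W)\<close>, approximating objects of \<open>W\<close>
  by objects of \<open>U\<close> identifies \<open>Hom(X, Y)\<close> for \<open>X, Y \<in> W\<close> with \<open>Hom(A, B)\<close> for \<open>A, B \<in> U\<close>,
  naturally with respect to the functor. Hence full faithfulness passes, and essential
  surjectivity passes by uniqueness of reflections, from \<open>U\<close> to \<open>W\<close>, that is, from index \<open>t\<close>
  to \<open>t + 2\<close>; if \<open>n\<close> is odd, they reach \<open>t + 1\<close>.
  So in both cases the functor is well-behaved on two neighbours \<open>U\<close> and \<open>V\<close>. The coreflections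
  onto \<open>U\<close> and \<open>V\<close> extend bijectivity to \<open>Hom(A, Y)\<close> with \<open>A \<in> U \<union> V\<close> and arbitrary \<open>Y\<close>, the five
  lemma along \<open>A \<rightarrow> X \<rightarrow> B \<rightarrow> \<Sigma> A\<close> extends it to all \<open>Hom(X, Y)\<close>, and any object of the
  target is up to translation the cone of a map that lifts, by fullness.
\<close>

section \<open>Categories and equivalences\<close>

text \<open>Serves to compare \<open>Fa\<close> on two hom-sets: \<open>f\<close> and
  \<open>g\<close> will be composition with an arrow and with its image, while \<open>h\<close> and
  \<open>k\<close> will both be \<open>Fa\<close>.\<close>

lemma bij_betw_square:
  assumes f: "bij_betw f A B" and g: "bij_betw g A' B'" and h: "h ` A \<subseteq> A'"
    and comm: "\<And>x. x \<in> A \<Longrightarrow> g (h x) = k (f x)"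
  shows "bij_betw h A A' \<longleftrightarrow> bij_betw k B B'"
proof -
  have "bij_betw h A A' \<longleftrightarrow> bij_betw (g \<circ> h) A B'"
    by (rule bij_betw_comp_iff2[OF g h])
  also have "\<dots> \<longleftrightarrow> bij_betw (k \<circ> f) A B'"
    by (rule bij_betw_cong) (simp add: comm)
  also have "\<dots> \<longleftrightarrow> bij_betw k B B'"
    by (rule bij_betw_comp_iff[OF f, symmetric])
  finally show ?thesis .
qed

definition essentially_surjective ::
  "('o1, 'm1, 'x) cat_data_scheme \<Rightarrow> ('o2, 'm2, 'y) cat_data_scheme \<Rightarrow> ('o1 \<Rightarrow> 'o2) \<Rightarrow> bool"
  where "essentially_surjective C D Fo \<longleftrightarrow> (\<forall>Y \<in> Ob D. \<exists>X \<in> Ob C. iso_objs D (Fo X) Y)"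

lemma iso_arr_hom: "iso_arr C X Y f \<Longrightarrow> f \<in> Hom C X Y"
  by (simp add: iso_arr_def)

lemma iso_arr_inverse:
  assumes "iso_arr C X Y f"
  obtains g where "iso_arr C Y X g" "g \<odot>\<^bsub>C\<^esub> f = Ident C X" "f \<odot>\<^bsub>C\<^esub> g = Ident C Y"
  using assms unfolding iso_arr_def by blast

section \<open>Isomorphisms and universal arrows in a category\<close>

context category
begin

lemma hom_dom: "f \<in> Hom C X Y \<Longrightarrow> X \<in> Ob C"
  using dom_closed by (auto simp: Hom_def)

lemma hom_cod: "f \<in> Hom C X Y \<Longrightarrow> Y \<in> Ob C"
  using cod_closed by (auto simp: Hom_def)

lemma iso_arr_comp:
  assumes f: "iso_arr C X Y f" and g: "iso_arr C Y Z g"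
  shows "iso_arr C X Z (g \<odot> f)"
proof -
  note fh = iso_arr_hom[OF f] and gh = iso_arr_hom[OF g]
  obtain f' where f': "iso_arr C Y X f'" "f' \<odot> f = Ident C X" "f \<odot> f' = Ident C Y"
    using f by (rule iso_arr_inverse)
  obtain g' where g': "iso_arr C Z Y g'" "g' \<odot> g = Ident C Y" "g \<odot> g' = Ident C Z"
    using g by (rule iso_arr_inverse)
  note fh' = iso_arr_hom[OF f'(1)] and gh' = iso_arr_hom[OF g'(1)]
  have "(f' \<odot> g') \<odot> (g \<odot> f) = f' \<odot> ((g' \<odot> g) \<odot> f)"
    using comp_assoc[OF comp_hom[OF fh gh] gh' fh'] comp_assoc[OF fh gh gh'] by simp
  also have "\<dots> = Ident C X"
    using f'(2) g'(2) comp_ident_left[OF fh] by simp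
  finally have 1: "(f' \<odot> g') \<odot> (g \<odot> f) = Ident C X" .
  have "(g \<odot> f) \<odot> (f' \<odot> g') = g \<odot> ((f \<odot> f') \<odot> g')"
    using comp_assoc[OF comp_hom[OF gh' fh'] fh gh] comp_assoc[OF gh' fh' fh] by simp
  also have "\<dots> = Ident C Z"
    using f'(3) g'(3) comp_ident_left[OF gh'] by simp
  finally have 2: "(g \<odot> f) \<odot> (f' \<odot> g') = Ident C Z" .
  show ?thesis
    unfolding iso_arr_def using 1 2 comp_hom[OF fh gh] comp_hom[OF gh' fh'] by blast
qed

lemma iso_arr_ident: "X \<in> Ob C \<Longrightarrow> iso_arr C X X (Ident C X)"
  unfolding iso_arr_def using ident_hom comp_ident_left by blast

lemma iso_objs_refl: "X \<in> Ob C \<Longrightarrow> iso_objs C X X"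
  unfolding iso_objs_def using iso_arr_ident by blast

lemma iso_objs_trans: "iso_objs C X Y \<Longrightarrow> iso_objs C Y Z \<Longrightarrow> iso_objs C X Z"
  unfolding iso_objs_def using iso_arr_comp by blast

lemma iso_precomp_bij:
  assumes p: "iso_arr C X Y p"
  shows "bij_betw (\<lambda>u. u \<odot> p) (Hom C Y B) (Hom C X B)"
proof -
  note ph = iso_arr_hom[OF p]
  obtain q where q: "iso_arr C Y X q" "q \<odot> p = Ident C X" "p \<odot> q = Ident C Y"
    using p by (rule iso_arr_inverse)
  note qh = iso_arr_hom[OF q(1)]
  show ?thesis
    by (rule bij_betw_byWitness[where f' = "\<lambda>u. u \<odot> q"])
      (auto simp: comp_assoc[OF qh ph] comp_assoc[OF ph qh] q comp_ident_right
        intro: comp_hom[OF ph] comp_hom[OF qh])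
qed

lemma iso_postcomp_bij:
  assumes p: "iso_arr C X Y p"
  shows "bij_betw (\<lambda>u. p \<odot> u) (Hom C A X) (Hom C A Y)"
proof -
  note ph = iso_arr_hom[OF p]
  obtain q where q: "iso_arr C Y X q" "q \<odot> p = Ident C X" "p \<odot> q = Ident C Y"
    using p by (rule iso_arr_inverse)
  note qh = iso_arr_hom[OF q(1)]
  show ?thesis
    by (rule bij_betw_byWitness[where f' = "\<lambda>u. q \<odot> u"])
      (auto simp: comp_assoc[OF _ qh ph, symmetric] comp_assoc[OF _ ph qh, symmetric] q
        comp_ident_left intro: comp_hom[OF _ ph] comp_hom[OF _ qh])
qed

lemma iso_precomp_cancel:
  "iso_arr C X Y p \<Longrightarrow> u \<in> Hom C Y B \<Longrightarrow> v \<in> Hom C Y B \<Longrightarrow> u \<odot> p = v \<odot> p \<Longrightarrow> u = v"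
  using iso_precomp_bij[of X Y p B] by (auto simp: bij_betw_def dest: inj_onD)

lemma iso_postcomp_cancel:
  "iso_arr C X Y p \<Longrightarrow> u \<in> Hom C A X \<Longrightarrow> v \<in> Hom C A X \<Longrightarrow> p \<odot> u = p \<odot> v \<Longrightarrow> u = v"
  using iso_postcomp_bij[of X Y p A] by (auto simp: bij_betw_def dest: inj_onD)

lemma iso_postcomp_factor:
  assumes "iso_arr C X Y p" "v \<in> Hom C A Y"
  obtains u where "u \<in> Hom C A X" "p \<odot> u = v"
  using iso_postcomp_bij[OF assms(1), of A] assms(2) by (force simp: bij_betw_def)

text \<open>Here \<open>p\<close> and \<open>q\<close> are two reflections of \<open>X\<close> into
  \<open>S\<close>: each factors through the other, and uniqueness of factorizations makes the two
  comparison arrows mutually inverse.\<close>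

lemma iso_from_universal:
  assumes p: "p \<in> Hom C X Y" and q: "q \<in> Hom C X Z" and Y: "Y \<in> S" and Z: "Z \<in> S"
    and pb: "\<And>B. B \<in> S \<Longrightarrow> bij_betw (\<lambda>u. u \<odot> p) (Hom C Y B) (Hom C X B)"
    and qb: "\<And>B. B \<in> S \<Longrightarrow> bij_betw (\<lambda>u. u \<odot> q) (Hom C Z B) (Hom C X B)"
  shows "iso_objs C Y Z"
proof -
  obtain a where a: "a \<in> Hom C Y Z" "a \<odot> p = q"
    using pb[OF Z] q by (force simp: bij_betw_def)
  obtain b where b: "b \<in> Hom C Z Y" "b \<odot> q = p"
    using qb[OF Y] p by (force simp: bij_betw_def)
  have "(b \<odot> a) \<odot> p = Ident C Y \<odot> p"
    using comp_assoc[OF p a(1) b(1)] a b comp_ident_left[OF p] by simp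
  hence 1: "b \<odot> a = Ident C Y"
    using pb[OF Y] comp_hom[OF a(1) b(1)] ident_hom[OF hom_cod[OF p]]
    by (auto simp: bij_betw_def dest: inj_onD)
  have "(a \<odot> b) \<odot> q = Ident C Z \<odot> q"
    using comp_assoc[OF q b(1) a(1)] a b comp_ident_left[OF q] by simp
  hence 2: "a \<odot> b = Ident C Z"
    using qb[OF Z] comp_hom[OF b(1) a(1)] ident_hom[OF hom_cod[OF q]]
    by (auto simp: bij_betw_def dest: inj_onD)
  show ?thesis
    unfolding iso_objs_def iso_arr_def using 1 2 a b by blast
qed

end

section \<open>Equivalences as fully faithful and essentially surjective functors\<close>

context cat_functor
begin

text \<open>Full faithfulness is localised to one pair of objects because the argument spreads
  bijectivity from pair to pair.\<close>

definition ff_at :: "'o1 \<Rightarrow> 'o1 \<Rightarrow> bool"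
  where "ff_at X Y \<longleftrightarrow> bij_betw Fa (Hom C X Y) (Hom D (Fo X) (Fo Y))"

lemma ff_at_inj:
  "ff_at X Y \<Longrightarrow> f \<in> Hom C X Y \<Longrightarrow> g \<in> Hom C X Y \<Longrightarrow> Fa f = Fa g \<Longrightarrow> f = g"
  by (auto simp: ff_at_def bij_betw_def dest: inj_onD)

lemma ff_at_surj:
  assumes "ff_at X Y" "h \<in> Hom D (Fo X) (Fo Y)"
  obtains f where "f \<in> Hom C X Y" "Fa f = h"
  using assms by (force simp: ff_at_def bij_betw_def)

lemma fully_faithful_iff_ff_at:
  "fully_faithful C D Fo Fa \<longleftrightarrow> (\<forall>X \<in> Ob C. \<forall>Y \<in> Ob C. ff_at X Y)"
  unfolding fully_faithful_def ff_at_def using cat_functor_axioms by blast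

lemma map_iso:
  assumes "iso_arr C X Y f"
  shows "iso_arr D (Fo X) (Fo Y) (Fa f)"
proof -
  note fh = iso_arr_hom[OF assms]
  obtain g where g: "iso_arr C Y X g" "g \<odot>\<^bsub>C\<^esub> f = Ident C X" "f \<odot>\<^bsub>C\<^esub> g = Ident C Y"
    using assms by (rule iso_arr_inverse)
  note gh = iso_arr_hom[OF g(1)]
  have "Fa g \<odot>\<^bsub>D\<^esub> Fa f = Ident D (Fo X)" "Fa f \<odot>\<^bsub>D\<^esub> Fa g = Ident D (Fo Y)"
    using map_comp[OF fh gh] map_comp[OF gh fh] g map_ident C.hom_dom[OF fh] C.hom_cod[OF fh]
    by simp_all
  thus ?thesis
    unfolding iso_arr_def using map_hom[OF fh] map_hom[OF gh] by blast
qed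

text \<open>Functoriality makes the square formed by \<open>Fa\<close> and precomposition with
  \<open>p\<close> and \<open>Fa p\<close> commute, and two opposite sides are bijective by
  hypothesis.\<close>

lemma ff_at_precomp:
  assumes p: "p \<in> Hom C X Y"
    and "bij_betw (\<lambda>u. u \<odot>\<^bsub>C\<^esub> p) (Hom C Y B) (Hom C X B)"
    and "bij_betw (\<lambda>u. u \<odot>\<^bsub>D\<^esub> Fa p) (Hom D (Fo Y) (Fo B)) (Hom D (Fo X) (Fo B))"
  shows "ff_at Y B \<longleftrightarrow> ff_at X B"
  unfolding ff_at_def
  by (rule bij_betw_square[OF assms(2,3)]) (auto simp: map_comp[OF p] map_hom)

lemma ff_at_postcomp:
  assumes p: "p \<in> Hom C X Y"
    and "bij_betw (\<lambda>u. p \<odot>\<^bsub>C\<^esub> u) (Hom C A X) (Hom C A Y)"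
    and "bij_betw (\<lambda>u. Fa p \<odot>\<^bsub>D\<^esub> u) (Hom D (Fo A) (Fo X)) (Hom D (Fo A) (Fo Y))"
  shows "ff_at A X \<longleftrightarrow> ff_at A Y"
  unfolding ff_at_def
  by (rule bij_betw_square[OF assms(2,3)]) (auto simp: map_comp[OF _ p] map_hom)

lemma ff_at_iso_dom:
  assumes "iso_arr C X Y p"
  shows "ff_at Y B \<longleftrightarrow> ff_at X B"
  using ff_at_precomp[OF iso_arr_hom[OF assms] C.iso_precomp_bij[OF assms]
      D.iso_precomp_bij[OF map_iso[OF assms]]] .

text \<open>Naturality of the invertible \<open>\<eta>\<close> recovers \<open>f\<close> from
  \<open>Ga (Fa f)\<close>, so \<open>Fa\<close> is faithful; \<open>\<epsilon>\<close> does the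
  same for \<open>Ga\<close>. Fullness of \<open>Fa\<close> then uses faithfulness of
  \<open>Ga\<close>.\<close>

lemma equivalence_imp_ff_ess_surj:
  assumes "cat_equivalence C D Fo Fa"
  shows "fully_faithful C D Fo Fa" "essentially_surjective C D Fo"
proof -
  obtain Go Ga \<eta> \<epsilon> where G: "cat_functor D C Go Ga"
    and \<eta>: "natural_iso C C id id (Go \<circ> Fo) (Ga \<circ> Fa) \<eta>"
    and \<epsilon>: "natural_iso D D (Fo \<circ> Go) (Fa \<circ> Ga) id id \<epsilon>"
    using assms unfolding cat_equivalence_def by blast
  interpret G: cat_functor D C Go Ga by fact
  have \<eta>i: "iso_arr C X (Go (Fo X)) (\<eta> X)" if "X \<in> Ob C" for X
    using \<eta> that by (simp add: natural_iso_def)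
  have \<eta>n: "\<eta> Y \<odot>\<^bsub>C\<^esub> f = Ga (Fa f) \<odot>\<^bsub>C\<^esub> \<eta> X" if "f \<in> Hom C X Y" for X Y f
    using \<eta> that C.hom_dom[OF that] C.hom_cod[OF that] by (simp add: natural_iso_def)
  have \<epsilon>i: "iso_arr D (Fo (Go Y)) Y (\<epsilon> Y)" if "Y \<in> Ob D" for Y
    using \<epsilon> that by (simp add: natural_iso_def)
  have \<epsilon>n: "\<epsilon> Y \<odot>\<^bsub>D\<^esub> Fa (Ga g) = g \<odot>\<^bsub>D\<^esub> \<epsilon> X" if "g \<in> Hom D X Y" for X Y g
    using \<epsilon> that D.hom_dom[OF that] D.hom_cod[OF that] by (simp add: natural_iso_def)
  show "essentially_surjective C D Fo"
    unfolding essentially_surjective_def iso_objs_def using \<epsilon>i G.map_ob by blast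
  have faith: "f = f'"
    if "f \<in> Hom C X Y" "f' \<in> Hom C X Y" "Ga (Fa f) = Ga (Fa f')" for X Y f f'
    using C.iso_postcomp_cancel[OF \<eta>i that(1,2)] that(3) \<eta>n[OF that(1)] \<eta>n[OF that(2)]
      C.hom_cod[OF that(1)] by simp
  have Gfaith: "g = g'"
    if "g \<in> Hom D X Y" "g' \<in> Hom D X Y" "Ga g = Ga g'" for X Y g g'
    using D.iso_precomp_cancel[OF \<epsilon>i that(1,2)] that(3) \<epsilon>n[OF that(1)] \<epsilon>n[OF that(2)]
      D.hom_dom[OF that(1)] by simp
  have "bij_betw Fa (Hom C X Y) (Hom D (Fo X) (Fo Y))" if X: "X \<in> Ob C" and Y: "Y \<in> Ob C" for X Y
    unfolding bij_betw_def
  proof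
    show "inj_on Fa (Hom C X Y)"
      using faith by (auto intro: inj_onI)
    have "h \<in> Fa ` Hom C X Y" if h: "h \<in> Hom D (Fo X) (Fo Y)" for h
    proof -
      note \<eta>X = iso_arr_hom[OF \<eta>i[OF X]]
      \<comment> \<open>The only candidate for a preimage of \<open>h\<close>: naturality of
        \<open>\<eta>\<close> would force this equation if \<open>Fa f = h\<close>.\<close>
      obtain f where f: "f \<in> Hom C X Y" "\<eta> Y \<odot>\<^bsub>C\<^esub> f = Ga h \<odot>\<^bsub>C\<^esub> \<eta> X"
        using C.iso_postcomp_factor[OF \<eta>i[OF Y] C.comp_hom[OF \<eta>X G.map_hom[OF h]]] by blast
      have "Ga (Fa f) = Ga h"
        by (rule C.iso_precomp_cancel[OF \<eta>i[OF X] G.map_hom[OF map_hom[OF f(1)]] G.map_hom[OF h]])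
          (use \<eta>n[OF f(1)] f(2) in simp)
      hence "Fa f = h"
        by (rule Gfaith[OF map_hom[OF f(1)] h])
      thus ?thesis using f(1) by blast
    qed
    thus "Fa ` Hom C X Y = Hom D (Fo X) (Fo Y)"
      using map_hom by blast
  qed
  thus "fully_faithful C D Fo Fa"
    unfolding fully_faithful_def using cat_functor_axioms by blast
qed

text \<open>Each arrow \<open>Fo X \<rightarrow> Y\<close> is \<open>\<epsilon> Y\<close> after
  \<open>Fa\<close> of exactly one arrow \<open>X \<rightarrow> Go Y\<close>. Existence defines
  \<open>Ga\<close> and \<open>\<eta>\<close>; uniqueness yields functoriality and
  naturality.\<close>

lemma ff_ess_surj_imp_equivalence:
  assumes ff: "fully_faithful C D Fo Fa" and es: "essentially_surjective C D Fo"
  shows "cat_equivalence C D Fo Fa"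
proof -
  have P: "ff_at X Y" if "X \<in> Ob C" "Y \<in> Ob C" for X Y
    using ff that by (simp add: fully_faithful_iff_ff_at)
  have "\<exists>X e. X \<in> Ob C \<and> iso_arr D (Fo X) Y e" if "Y \<in> Ob D" for Y
    using es that unfolding essentially_surjective_def iso_objs_def by blast
  then obtain Go \<epsilon> where Go: "\<And>Y. Y \<in> Ob D \<Longrightarrow> Go Y \<in> Ob C"
    and \<epsilon>: "\<And>Y. Y \<in> Ob D \<Longrightarrow> iso_arr D (Fo (Go Y)) Y (\<epsilon> Y)"
    by metis
  have lift: "\<exists>f \<in> Hom C X (Go Y). \<epsilon> Y \<odot>\<^bsub>D\<^esub> Fa f = g"
    if X: "X \<in> Ob C" and Y: "Y \<in> Ob D" and g: "g \<in> Hom D (Fo X) Y" for X Y g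
  proof -
    obtain h where h: "h \<in> Hom D (Fo X) (Fo (Go Y))" "\<epsilon> Y \<odot>\<^bsub>D\<^esub> h = g"
      using D.iso_postcomp_factor[OF \<epsilon>[OF Y] g] .
    obtain f where "f \<in> Hom C X (Go Y)" "Fa f = h"
      using ff_at_surj[OF P[OF X Go[OF Y]] h(1)] .
    with h show ?thesis by blast
  qed
  have uniq: "f = f'"
    if "f \<in> Hom C X (Go Y)" "f' \<in> Hom C X (Go Y)" "Y \<in> Ob D"
      "\<epsilon> Y \<odot>\<^bsub>D\<^esub> Fa f = \<epsilon> Y \<odot>\<^bsub>D\<^esub> Fa f'" for X Y f f'
    using ff_at_inj[OF P[OF C.hom_dom[OF that(1)] Go[OF that(3)]] that(1,2)]
      D.iso_postcomp_cancel[OF \<epsilon>[OF that(3)] map_hom[OF that(1)] map_hom[OF that(2)] that(4)]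
    by simp
  \<comment> \<open>\<open>X\<close> and \<open>Y\<close> are quantified inside so that
    \<open>Ga\<close> can be chosen as a function of the arrow alone. \<open>Dom\<close> and
    \<open>Cod\<close> determine them, and off \<open>Arr D\<close> the claim is vacuous.\<close>
  have "\<exists>f. \<forall>X Y. g \<in> Hom D X Y \<longrightarrow>
      f \<in> Hom C (Go X) (Go Y) \<and> \<epsilon> Y \<odot>\<^bsub>D\<^esub> Fa f = g \<odot>\<^bsub>D\<^esub> \<epsilon> X" for g
  proof (cases "g \<in> Arr D")
    case True
    define X where "X = Dom D g"
    define Y where "Y = Cod D g"
    have g: "g \<in> Hom D X Y" using True by (simp add: Hom_def X_def Y_def)
    have "\<exists>f \<in> Hom C (Go X) (Go Y). \<epsilon> Y \<odot>\<^bsub>D\<^esub> Fa f = g \<odot>\<^bsub>D\<^esub> \<epsilon> X"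
      using lift[OF Go D.hom_cod[OF g] D.comp_hom[OF iso_arr_hom[OF \<epsilon>] g]] D.hom_dom[OF g] by blast
    thus ?thesis by (auto simp: Hom_def X_def Y_def)
  qed (simp add: Hom_def)
  then obtain Ga where Ga: "\<And>X Y g. g \<in> Hom D X Y \<Longrightarrow> Ga g \<in> Hom C (Go X) (Go Y)"
    and Gn: "\<And>X Y g. g \<in> Hom D X Y \<Longrightarrow> \<epsilon> Y \<odot>\<^bsub>D\<^esub> Fa (Ga g) = g \<odot>\<^bsub>D\<^esub> \<epsilon> X"
    by metis
  \<comment> \<open>As \<open>\<epsilon> (Fo X)\<close> is invertible, \<open>\<eta> X\<close> will
    be the lift of its inverse.\<close>
  have "\<exists>f \<in> Hom C X (Go (Fo X)). \<epsilon> (Fo X) \<odot>\<^bsub>D\<^esub> Fa f = Ident D (Fo X)" if "X \<in> Ob C" for X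
    using lift that map_ob[OF that] D.ident_hom by blast
  then obtain \<eta> where \<eta>: "\<And>X. X \<in> Ob C \<Longrightarrow> \<eta> X \<in> Hom C X (Go (Fo X))"
    and \<eta>e: "\<And>X. X \<in> Ob C \<Longrightarrow> \<epsilon> (Fo X) \<odot>\<^bsub>D\<^esub> Fa (\<eta> X) = Ident D (Fo X)"
    by metis
  have Gcomp: "Ga (h \<odot>\<^bsub>D\<^esub> g) = Ga h \<odot>\<^bsub>C\<^esub> Ga g"
    if g: "g \<in> Hom D X Y" and h: "h \<in> Hom D Y Z" for X Y Z g h
  proof (rule uniq[OF Ga[OF D.comp_hom[OF g h]] C.comp_hom[OF Ga[OF g] Ga[OF h]] D.hom_cod[OF h]])
    note e = iso_arr_hom[OF \<epsilon>]
    have "\<epsilon> Z \<odot>\<^bsub>D\<^esub> Fa (Ga h \<odot>\<^bsub>C\<^esub> Ga g) = (\<epsilon> Z \<odot>\<^bsub>D\<^esub> Fa (Ga h)) \<odot>\<^bsub>D\<^esub> Fa (Ga g)"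
      using map_comp[OF Ga[OF g] Ga[OF h]]
        D.comp_assoc[OF map_hom[OF Ga[OF g]] map_hom[OF Ga[OF h]] e[OF D.hom_cod[OF h]]] by simp
    also have "\<dots> = h \<odot>\<^bsub>D\<^esub> (\<epsilon> Y \<odot>\<^bsub>D\<^esub> Fa (Ga g))"
      using Gn[OF h] D.comp_assoc[OF map_hom[OF Ga[OF g]] e[OF D.hom_dom[OF h]] h] by simp
    also have "\<dots> = (h \<odot>\<^bsub>D\<^esub> g) \<odot>\<^bsub>D\<^esub> \<epsilon> X"
      using Gn[OF g] D.comp_assoc[OF e[OF D.hom_dom[OF g]] g h] by simp
    finally show "\<epsilon> Z \<odot>\<^bsub>D\<^esub> Fa (Ga (h \<odot>\<^bsub>D\<^esub> g)) = \<epsilon> Z \<odot>\<^bsub>D\<^esub> Fa (Ga h \<odot>\<^bsub>C\<^esub> Ga g)"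
      using Gn[OF D.comp_hom[OF g h]] by simp
  qed
  have Gid: "Ga (Ident D X) = Ident C (Go X)" if X: "X \<in> Ob D" for X
  proof (rule uniq[OF Ga[OF D.ident_hom[OF X]] C.ident_hom[OF Go[OF X]] X])
    note e = iso_arr_hom[OF \<epsilon>[OF X]]
    show "\<epsilon> X \<odot>\<^bsub>D\<^esub> Fa (Ga (Ident D X)) = \<epsilon> X \<odot>\<^bsub>D\<^esub> Fa (Ident C (Go X))"
      using Gn[OF D.ident_hom[OF X]] map_ident[OF Go[OF X]] D.comp_ident_left[OF e]
        D.comp_ident_right[OF e] by simp
  qed
  have G: "cat_functor D C Go Ga"
    by (intro cat_functor.intro cat_functor_axioms.intro C.category_axioms D.category_axioms
        Go Ga Gid Gcomp)
  have \<eta>i: "iso_arr C X (Go (Fo X)) (\<eta> X)" if X: "X \<in> Ob C" for X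
  proof -
    note FX = map_ob[OF X] and hX = \<eta>[OF X]
    note e = iso_arr_hom[OF \<epsilon>[OF FX]]
    \<comment> \<open>The lift of \<open>\<epsilon> (Fo X)\<close> itself, which turns out to be the
      inverse of \<open>\<eta> X\<close>.\<close>
    obtain \<theta> where \<theta>: "\<theta> \<in> Hom C (Go (Fo X)) X" "Fa \<theta> = \<epsilon> (Fo X)"
      using ff_at_surj[OF P[OF Go[OF FX] X] e] .
    have 1: "\<theta> \<odot>\<^bsub>C\<^esub> \<eta> X = Ident C X"
      by (rule ff_at_inj[OF P[OF X X] C.comp_hom[OF hX \<theta>(1)] C.ident_hom[OF X]])
        (simp add: map_comp[OF hX \<theta>(1)] \<theta>(2) \<eta>e[OF X] map_ident[OF X])
    have 2: "\<eta> X \<odot>\<^bsub>C\<^esub> \<theta> = Ident C (Go (Fo X))"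
    proof (rule uniq[OF C.comp_hom[OF \<theta>(1) hX] C.ident_hom[OF Go[OF FX]] FX])
      show "\<epsilon> (Fo X) \<odot>\<^bsub>D\<^esub> Fa (\<eta> X \<odot>\<^bsub>C\<^esub> \<theta>) = \<epsilon> (Fo X) \<odot>\<^bsub>D\<^esub> Fa (Ident C (Go (Fo X)))"
        using D.comp_assoc[OF map_hom[OF \<theta>(1)] map_hom[OF hX] e] map_comp[OF \<theta>(1) hX] \<eta>e[OF X]
          \<theta>(2) D.comp_ident_left[OF e] D.comp_ident_right[OF e] map_ident[OF Go[OF FX]] by simp
    qed
    show ?thesis unfolding iso_arr_def using 1 2 hX \<theta>(1) by blast
  qed
  have \<eta>n: "\<eta> Y \<odot>\<^bsub>C\<^esub> f = Ga (Fa f) \<odot>\<^bsub>C\<^esub> \<eta> X" if f: "f \<in> Hom C X Y" for X Y f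
  proof -
    note X = C.hom_dom[OF f] and Y = C.hom_cod[OF f]
    note hX = \<eta>[OF X] and hY = \<eta>[OF Y]
    note GF = Ga[OF map_hom[OF f]]
    note eX = iso_arr_hom[OF \<epsilon>[OF map_ob[OF X]]] and eY = iso_arr_hom[OF \<epsilon>[OF map_ob[OF Y]]]
    show ?thesis
    proof (rule uniq[OF C.comp_hom[OF f hY] C.comp_hom[OF hX GF] map_ob[OF Y]])
      have "\<epsilon> (Fo Y) \<odot>\<^bsub>D\<^esub> Fa (\<eta> Y \<odot>\<^bsub>C\<^esub> f) = Fa f"
        using map_comp[OF f hY] D.comp_assoc[OF map_hom[OF f] map_hom[OF hY] eY] \<eta>e[OF Y]
          D.comp_ident_left[OF map_hom[OF f]] by simp
      also have "\<dots> = (Fa f \<odot>\<^bsub>D\<^esub> \<epsilon> (Fo X)) \<odot>\<^bsub>D\<^esub> Fa (\<eta> X)"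
        using D.comp_assoc[OF map_hom[OF hX] eX map_hom[OF f]] \<eta>e[OF X]
          D.comp_ident_right[OF map_hom[OF f]] by simp
      also have "\<dots> = \<epsilon> (Fo Y) \<odot>\<^bsub>D\<^esub> Fa (Ga (Fa f) \<odot>\<^bsub>C\<^esub> \<eta> X)"
        using Gn[OF map_hom[OF f]] map_comp[OF hX GF]
          D.comp_assoc[OF map_hom[OF hX] map_hom[OF GF] eY] by simp
      finally show "\<epsilon> (Fo Y) \<odot>\<^bsub>D\<^esub> Fa (\<eta> Y \<odot>\<^bsub>C\<^esub> f) = \<epsilon> (Fo Y) \<odot>\<^bsub>D\<^esub> Fa (Ga (Fa f) \<odot>\<^bsub>C\<^esub> \<eta> X)" .
    qed
  qed
  have "natural_iso C C id id (Go \<circ> Fo) (Ga \<circ> Fa) \<eta>"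
    using \<eta>i \<eta>n by (simp add: natural_iso_def)
  moreover have "natural_iso D D (Fo \<circ> Go) (Fa \<circ> Ga) id id \<epsilon>"
    using \<epsilon> Gn by (simp add: natural_iso_def)
  ultimately show ?thesis
    unfolding cat_equivalence_def using cat_functor_axioms G by blast
qed

lemma cat_equivalence_iff:
  "cat_equivalence C D Fo Fa \<longleftrightarrow> fully_faithful C D Fo Fa \<and> essentially_surjective C D Fo"
  using equivalence_imp_ff_ess_surj ff_ess_surj_imp_equivalence by blast

end

section \<open>Exactness in triangulated categories\<close>

context additive_category
begin

lemma zero_hom: "X \<in> Ob C \<Longrightarrow> Y \<in> Ob C \<Longrightarrow> HomZero C X Y \<in> Hom C X Y"
  using comm_group.axioms(2)[OF hom_group, THEN group.is_monoid, THEN monoid.one_closed, of X Y]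
  by (simp add: HomGroup_def)

lemma add_hom:
  assumes "f \<in> Hom C X Y" "g \<in> Hom C X Y"
  shows "HomAdd C f g \<in> Hom C X Y"
proof -
  interpret G: comm_group "HomGroup C X Y"
    by (rule hom_group[OF hom_dom[OF assms(1)] hom_cod[OF assms(1)]])
  show ?thesis using G.m_closed[of f g] assms by (simp add: HomGroup_def)
qed

lemma add_zero_left:
  assumes "f \<in> Hom C X Y"
  shows "HomAdd C (HomZero C X Y) f = f"
proof -
  interpret G: comm_group "HomGroup C X Y"
    by (rule hom_group[OF hom_dom[OF assms(1)] hom_cod[OF assms(1)]])
  show ?thesis using G.l_one[of f] assms by (simp add: HomGroup_def)
qed

lemma add_eq_self:
  assumes "f \<in> Hom C X Y" "g \<in> Hom C X Y" "HomAdd C f g = g"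
  shows "f = HomZero C X Y"
proof -
  interpret G: comm_group "HomGroup C X Y"
    by (rule hom_group[OF hom_dom[OF assms(1)] hom_cod[OF assms(1)]])
  show ?thesis using G.r_cancel_one[of g f] assms by (simp add: HomGroup_def)
qed

text \<open>Differences enter as a \<open>d\<close> that adds with \<open>g\<close> to
  \<open>f\<close>, so that bilinearity of composition applies directly and
  \<open>add_eq_self\<close> detects when \<open>d\<close> vanishes.\<close>

lemma hom_diff:
  assumes "f \<in> Hom C X Y" "g \<in> Hom C X Y"
  obtains d where "d \<in> Hom C X Y" "HomAdd C d g = f"
proof -
  interpret G: comm_group "HomGroup C X Y"
    by (rule hom_group[OF hom_dom[OF assms(1)] hom_cod[OF assms(1)]])
  let ?G = "HomGroup C X Y"
  have f: "f \<in> carrier ?G" and g: "g \<in> carrier ?G"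
    using assms by (auto simp: HomGroup_def)
  have "(f \<otimes>\<^bsub>?G\<^esub> inv\<^bsub>?G\<^esub> g) \<otimes>\<^bsub>?G\<^esub> g = f"
    using f g by (simp add: G.m_assoc)
  moreover have "f \<otimes>\<^bsub>?G\<^esub> inv\<^bsub>?G\<^esub> g \<in> carrier ?G"
    using f g by simp
  ultimately show thesis
    by (intro that) (auto simp: HomGroup_def)
qed

lemma comp_zero_right:
  assumes X: "X \<in> Ob C" and g: "g \<in> Hom C Y Z"
  shows "g \<odot> HomZero C X Y = HomZero C X Z"
proof -
  have z: "HomZero C X Y \<in> Hom C X Y"
    using X hom_dom[OF g] by (rule zero_hom)
  show ?thesis
    by (rule add_eq_self[OF comp_hom[OF z g] comp_hom[OF z g]])
      (metis add_zero_left[OF z] comp_add_right[OF z z g])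
qed

lemma comp_zero_left:
  assumes f: "f \<in> Hom C X Y" and Z: "Z \<in> Ob C"
  shows "HomZero C Y Z \<odot> f = HomZero C X Z"
proof -
  have z: "HomZero C Y Z \<in> Hom C Y Z"
    using hom_cod[OF f] Z by (rule zero_hom)
  show ?thesis
    by (rule add_eq_self[OF comp_hom[OF f z] comp_hom[OF f z]])
      (metis add_zero_left[OF z] comp_add_left[OF f z z])
qed

lemma
  assumes f: "f \<in> Hom C X Y"
  shows neg_hom: "HomNeg C f \<in> Hom C X Y"
    and add_neg: "HomAdd C f (HomNeg C f) = HomZero C X Y"
    and neg_neg: "HomNeg C (HomNeg C f) = f"
proof -
  interpret G: comm_group "HomGroup C X Y"
    by (rule hom_group[OF hom_dom[OF f] hom_cod[OF f]])
  have fc: "f \<in> carrier (HomGroup C X Y)"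
    using f by (simp add: HomGroup_def)
  have n: "HomNeg C f = inv\<^bsub>HomGroup C X Y\<^esub> f"
    using f by (simp add: HomNeg_def Hom_def)
  show 1: "HomNeg C f \<in> Hom C X Y"
    using G.inv_closed[OF fc] by (simp add: n) (simp add: HomGroup_def)
  show "HomAdd C f (HomNeg C f) = HomZero C X Y"
    using G.r_inv[OF fc] by (simp add: n) (simp add: HomGroup_def)
  have "HomNeg C (HomNeg C f) = inv\<^bsub>HomGroup C X Y\<^esub> (HomNeg C f)"
    using 1 by (simp add: HomNeg_def Hom_def)
  thus "HomNeg C (HomNeg C f) = f"
    using G.inv_inv[OF fc] by (simp add: n)
qed

lemma neg_unique:
  assumes "f \<in> Hom C X Y" "g \<in> Hom C X Y" "HomAdd C f g = HomZero C X Y"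
  shows "g = HomNeg C f"
proof -
  interpret G: comm_group "HomGroup C X Y"
    by (rule hom_group[OF hom_dom[OF assms(1)] hom_cod[OF assms(1)]])
  have "f \<in> carrier (HomGroup C X Y)" "g \<in> carrier (HomGroup C X Y)"
    "f \<otimes>\<^bsub>HomGroup C X Y\<^esub> g = \<one>\<^bsub>HomGroup C X Y\<^esub>"
    using assms by (simp_all add: HomGroup_def)
  hence "inv\<^bsub>HomGroup C X Y\<^esub> f = g"
    by (metis G.inv_equality G.m_comm)
  thus ?thesis
    using assms(1) by (simp add: HomNeg_def Hom_def)
qed

lemma comp_neg_right:
  assumes f: "f \<in> Hom C X Y" and g: "g \<in> Hom C Y Z"
  shows "g \<odot> HomNeg C f = HomNeg C (g \<odot> f)"
  by (rule neg_unique[OF comp_hom[OF f g] comp_hom[OF neg_hom[OF f] g]])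
    (metis comp_add_right[OF f neg_hom[OF f] g] add_neg[OF f] comp_zero_right[OF hom_dom[OF f] g])

lemma comp_neg_left:
  assumes f: "f \<in> Hom C X Y" and g: "g \<in> Hom C Y Z"
  shows "HomNeg C g \<odot> f = HomNeg C (g \<odot> f)"
  by (rule neg_unique[OF comp_hom[OF f g] comp_hom[OF f neg_hom[OF g]]])
    (metis comp_add_left[OF f g neg_hom[OF g]] add_neg[OF g] comp_zero_left[OF f hom_cod[OF g]])

lemma neg_zero: "X \<in> Ob C \<Longrightarrow> Y \<in> Ob C \<Longrightarrow> HomNeg C (HomZero C X Y) = HomZero C X Y"
  by (rule neg_unique[symmetric]) (simp_all add: zero_hom add_zero_left)

lemma hom_zero_eqI: "Hom C X Y = {HomZero C X Y} \<Longrightarrow> f \<in> Hom C X Y \<Longrightarrow> f = HomZero C X Y"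
  by simp

text \<open>Precomposition is additive, so a trivial kernel gives injectivity: the difference of two
  arrows with equal composites composes to zero with \<open>p\<close>.\<close>

lemma precomp_bijI:
  assumes p: "p \<in> Hom C X Y"
    and inj: "\<And>u. u \<in> Hom C Y B \<Longrightarrow> u \<odot> p = HomZero C X B \<Longrightarrow> u = HomZero C Y B"
    and surj: "\<And>v. v \<in> Hom C X B \<Longrightarrow> \<exists>u \<in> Hom C Y B. u \<odot> p = v"
  shows "bij_betw (\<lambda>u. u \<odot> p) (Hom C Y B) (Hom C X B)"
  unfolding bij_betw_def
proof
  show "inj_on (\<lambda>u. u \<odot> p) (Hom C Y B)"
  proof (rule inj_onI)
    fix u v assume u: "u \<in> Hom C Y B" and v: "v \<in> Hom C Y B" and eq: "u \<odot> p = v \<odot> p"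
    obtain d where d: "d \<in> Hom C Y B" "HomAdd C d v = u"
      using hom_diff[OF u v] .
    have "HomAdd C (d \<odot> p) (v \<odot> p) = v \<odot> p"
      using comp_add_left[OF p d(1) v] d(2) eq by simp
    hence "d = HomZero C Y B"
      using add_eq_self[OF comp_hom[OF p d(1)] comp_hom[OF p v]] inj[OF d(1)] by blast
    thus "u = v" using d(2) add_zero_left[OF v] by simp
  qed
  show "(\<lambda>u. u \<odot> p) ` Hom C Y B = Hom C X B"
    using surj comp_hom[OF p] by blast
qed

lemma postcomp_bijI:
  assumes p: "p \<in> Hom C X Y"
    and inj: "\<And>u. u \<in> Hom C A X \<Longrightarrow> p \<odot> u = HomZero C A Y \<Longrightarrow> u = HomZero C A X"
    and surj: "\<And>v. v \<in> Hom C A Y \<Longrightarrow> \<exists>u \<in> Hom C A X. p \<odot> u = v"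
  shows "bij_betw (\<lambda>u. p \<odot> u) (Hom C A X) (Hom C A Y)"
  unfolding bij_betw_def
proof
  show "inj_on (\<lambda>u. p \<odot> u) (Hom C A X)"
  proof (rule inj_onI)
    fix u v assume u: "u \<in> Hom C A X" and v: "v \<in> Hom C A X" and eq: "p \<odot> u = p \<odot> v"
    obtain d where d: "d \<in> Hom C A X" "HomAdd C d v = u"
      using hom_diff[OF u v] .
    have "HomAdd C (p \<odot> d) (p \<odot> v) = p \<odot> v"
      using comp_add_right[OF d(1) v p] d(2) eq by simp
    hence "d = HomZero C A X"
      using add_eq_self[OF comp_hom[OF d(1) p] comp_hom[OF v p]] inj[OF d(1)] by blast
    thus "u = v" using d(2) add_zero_left[OF v] by simp
  qed
  show "(\<lambda>u. p \<odot> u) ` Hom C A X = Hom C A Y"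
    using surj comp_hom[OF _ p] by blast
qed

text \<open>Composition with \<open>e\<close> is a bijection of hom-sets that preserves
  zero.\<close>

lemma hom_zero_iso_dom:
  assumes e: "iso_arr C X X' e" and B: "B \<in> Ob C" and z: "Hom C X' B = {HomZero C X' B}"
  shows "Hom C X B = {HomZero C X B}"
  using iso_precomp_bij[OF e, of B] comp_zero_left[OF iso_arr_hom[OF e] B]
  by (simp add: bij_betw_def z)

lemma hom_zero_iso_cod:
  assumes e: "iso_arr C Y Y' e" and A: "A \<in> Ob C" and z: "Hom C A Y = {HomZero C A Y}"
  shows "Hom C A Y' = {HomZero C A Y'}"
  using iso_postcomp_bij[OF e, of A] comp_zero_right[OF A iso_arr_hom[OF e]]
  by (simp add: bij_betw_def z)

text \<open>As for any square-zero element of a ring, \<open>1 - d\<close> is a two-sided inverse of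
  \<open>1 + d\<close>.\<close>

lemma square_zero_unit:
  assumes d: "d \<in> Hom C Z Z" and dd: "d \<odot> d = HomZero C Z Z"
  shows "\<exists>k \<in> Hom C Z Z. k \<odot> HomAdd C d (Ident C Z) = Ident C Z
    \<and> HomAdd C d (Ident C Z) \<odot> k = Ident C Z"
proof -
  note Z = hom_dom[OF d]
  note i = ident_hom[OF Z] and n = neg_hom[OF d]
  have ci: "comm_group (HomGroup C Z Z)" using hom_group Z by blast
  interpret G: comm_group "HomGroup C Z Z" by fact
  let ?k = "HomAdd C (HomNeg C d) (Ident C Z)"
  let ?u = "HomAdd C d (Ident C Z)"
  have nd: "HomNeg C d \<odot> d = HomZero C Z Z" "d \<odot> HomNeg C d = HomZero C Z Z"
    using comp_neg_left[OF d d] comp_neg_right[OF d d] dd neg_zero[OF Z Z] by simp_all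
  have k: "?k \<in> Hom C Z Z" and u: "?u \<in> Hom C Z Z"
    using add_hom n d i by simp_all
  have kd: "?k \<odot> d = d" and dk: "d \<odot> ?k = d"
    using comp_add_left[OF d n i] comp_add_right[OF n i d] nd comp_ident_left[OF d]
      comp_ident_right[OF d] add_zero_left[OF d] by simp_all
  have sum: "HomAdd C d ?k = Ident C Z"
  proof -
    have "HomAdd C d ?k = HomAdd C (HomAdd C d (HomNeg C d)) (Ident C Z)"
      using G.m_assoc[of d "HomNeg C d" "Ident C Z"] d n i by (simp add: HomGroup_def)
    thus ?thesis using add_neg[OF d] add_zero_left[OF i] by simp
  qed
  have "?k \<odot> ?u = Ident C Z"
    using comp_add_right[OF d i k] kd comp_ident_right[OF k] sum by simp
  moreover have "?u \<odot> ?k = Ident C Z"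
    using comp_add_left[OF k d i] dk comp_ident_left[OF k] sum by simp
  ultimately show ?thesis using k by blast
qed

end

context additive_functor
begin

lemma map_zero:
  assumes X: "X \<in> Ob C" and Y: "Y \<in> Ob C"
  shows "Fa (HomZero C X Y) = HomZero D (Fo X) (Fo Y)"
proof -
  note z = C.zero_hom[OF X Y]
  show ?thesis
    by (rule D.add_eq_self[OF map_hom[OF z] map_hom[OF z]])
      (metis C.add_zero_left[OF z] map_add[OF z z])
qed

lemma map_neg:
  assumes f: "f \<in> Hom C X Y"
  shows "Fa (HomNeg C f) = HomNeg D (Fa f)"
  by (rule D.neg_unique[OF map_hom[OF f] map_hom[OF C.neg_hom[OF f]]])
    (metis map_add[OF f C.neg_hom[OF f]] C.add_neg[OF f] map_zero C.hom_dom[OF f] C.hom_cod[OF f])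

lemma hom_zero_of_map_zero:
  assumes ff: "fully_faithful C D Fo Fa" and X: "X \<in> Ob C" and Y: "Y \<in> Ob C"
    and z: "Hom D (Fo X) (Fo Y) = {HomZero D (Fo X) (Fo Y)}"
  shows "Hom C X Y = {HomZero C X Y}"
proof -
  have P: "ff_at X Y" using ff X Y by (simp add: fully_faithful_iff_ff_at)
  have "f = HomZero C X Y" if f: "f \<in> Hom C X Y" for f
    using ff_at_inj[OF P f C.zero_hom[OF X Y]] map_hom[OF f] z map_zero[OF X Y] by simp
  thus ?thesis using C.zero_hom[OF X Y] by blast
qed

lemma map_zero_hom:
  assumes ff: "fully_faithful C D Fo Fa" and X: "X \<in> Ob C" and Y: "Y \<in> Ob C"
    and z: "Hom C X Y = {HomZero C X Y}"
  shows "Hom D (Fo X) (Fo Y) = {HomZero D (Fo X) (Fo Y)}"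
proof -
  have P: "ff_at X Y" using ff X Y by (simp add: fully_faithful_iff_ff_at)
  show ?thesis
    using P z map_zero[OF X Y] by (simp add: ff_at_def bij_betw_def)
qed

end

section \<open>Long exact Hom sequences of a triangle\<close>

context triangulated_category
begin

sublocale shift: additive_functor C C "ShiftO C" "ShiftA C"
  by (rule shift_additive)

lemma shift_ff: "fully_faithful C C (ShiftO C) (ShiftA C)"
  and shift_ess_surj: "essentially_surjective C C (ShiftO C)"
  using shift_equivalence shift.cat_equivalence_iff by blast+

lemma shift_ff_at: "X \<in> Ob C \<Longrightarrow> Y \<in> Ob C \<Longrightarrow> shift.ff_at X Y"
  using shift_ff shift.fully_faithful_iff_ff_at by blast

lemma shift_inj:
  "f \<in> Hom C X Y \<Longrightarrow> g \<in> Hom C X Y \<Longrightarrow> ShiftA C f = ShiftA C g \<Longrightarrow> f = g"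
  using shift.ff_at_inj[OF shift_ff_at] hom_dom hom_cod by blast

lemma shift_surj:
  assumes "X \<in> Ob C" "Y \<in> Ob C" "h \<in> Hom C (ShiftO C X) (ShiftO C Y)"
  obtains f where "f \<in> Hom C X Y" "ShiftA C f = h"
  using shift.ff_at_surj[OF shift_ff_at[OF assms(1,2)] assms(3)] .

lemma shift_hom_zero_iff:
  "X \<in> Ob C \<Longrightarrow> Y \<in> Ob C \<Longrightarrow>
   Hom C (ShiftO C X) (ShiftO C Y) = {HomZero C (ShiftO C X) (ShiftO C Y)} \<longleftrightarrow>
   Hom C X Y = {HomZero C X Y}"
  using shift.hom_zero_of_map_zero[OF shift_ff] shift.map_zero_hom[OF shift_ff] by blast

lemma dist_triangleD:
  assumes "dist_triangle C X Y Z f g h"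
  shows "f \<in> Hom C X Y" "g \<in> Hom C Y Z" "h \<in> Hom C Z (ShiftO C X)"
    "X \<in> Ob C" "Y \<in> Ob C" "Z \<in> Ob C"
  using assms hom_dom hom_cod by (auto simp: dist_triangle_def triangle_shape_def)

lemma tri_rot:
  assumes "dist_triangle C X Y Z f g h"
  shows "dist_triangle C Y Z (ShiftO C X) g h (HomNeg C (ShiftA C f))"
  using tri_rotate assms by (auto simp: dist_triangle_def)

lemma zero_hom_to:
  assumes "zero_object C N" "X \<in> Ob C" "f \<in> Hom C X N" "g \<in> Hom C X N"
  shows "f = g"
  using assms unfolding zero_object_def by blast

lemma zero_object_obtain: obtains N where "zero_object C N" "N \<in> Ob C"
  using zero_object_exists by (auto simp: zero_object_def)

lemma tri_comp_zero:
  assumes t: "dist_triangle C X Y Z f g h"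
  shows "g \<odot> f = HomZero C X Z"
proof -
  note D = dist_triangleD[OF t]
  obtain N where N: "zero_object C N" "N \<in> Ob C" by (rule zero_object_obtain)
  \<comment> \<open>The pair \<open>Ident C X\<close>, \<open>f\<close> maps the trivial triangle on
    \<open>X\<close> to the given one; the third component factors \<open>g \<odot> f\<close>
    through the zero object \<open>N\<close>.\<close>
  obtain c where c: "c \<in> Hom C N Z" "c \<odot> HomZero C X N = g \<odot> f"
    using tri_morphism[OF tri_ident[OF D(4) N(1)] t ident_hom[OF D(4)] D(1)] by blast
  show ?thesis
    using comp_zero_right[OF D(4) c(1)] c(2) by simp
qed

lemma tri_comp_zero':
  assumes t: "dist_triangle C X Y Z f g h"
  shows "ShiftA C f \<odot> h = HomZero C Z (ShiftO C Y)"
proof -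
  note D = dist_triangleD[OF t]
  note sf = shift.map_hom[OF D(1)]
  have sY: "ShiftO C Y \<in> Ob C" by (rule hom_cod[OF sf])
  have "HomNeg C (ShiftA C f) \<odot> h = HomZero C Z (ShiftO C Y)"
    by (rule tri_comp_zero[OF tri_rot[OF tri_rot[OF t]]])
  hence "HomNeg C (ShiftA C f \<odot> h) = HomZero C Z (ShiftO C Y)"
    using comp_neg_left[OF D(3) sf] by simp
  thus ?thesis
    using neg_neg[OF comp_hom[OF D(3) sf]] neg_zero[OF D(6) sY] by simp
qed

text \<open>The condition on \<open>u\<close> says that \<open>u\<close> and the zero arrow
  \<open>X \<rightarrow> N\<close> form a commuting square towards the triangle
  \<open>N \<rightarrow> B = B\<close>, with \<open>N\<close> a zero object. The third component of
  a morphism of triangles extending it is \<open>v\<close>.\<close>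

lemma contra_exact_middle:
  assumes t: "dist_triangle C X Y Z f g h" and u: "u \<in> Hom C Y B"
    and z: "u \<odot> f = HomZero C X B"
  shows "\<exists>v \<in> Hom C Z B. v \<odot> g = u"
proof -
  note D = dist_triangleD[OF t]
  note B = hom_cod[OF u]
  obtain N where N: "zero_object C N" "N \<in> Ob C" by (rule zero_object_obtain)
  note sN = shift.map_ob[OF N(2)]
  \<comment> \<open>In \<open>tri_ident\<close> the zero object is the third vertex. Rotating
    backwards moves it to the first place as \<open>N\<close> if the third vertex is
    \<open>ShiftO C N\<close>.\<close>
  have zsN: "zero_object C (ShiftO C N)"
    unfolding zero_object_def
  proof (intro conjI ballI)
    \<comment> \<open>On \<open>N\<close> the identity is zero; the translation preserves both, and
      an object whose identity is zero has only zero arrows in and out.\<close>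
    have zz: "ShiftA C (HomZero C N N) = ShiftA C (Ident C N)"
      using zero_hom_to[OF N zero_hom[OF N(2) N(2)] ident_hom[OF N(2)]] by simp
    hence i0: "Ident C (ShiftO C N) = HomZero C (ShiftO C N) (ShiftO C N)"
      using shift.map_ident[OF N(2)] shift.map_zero[OF N(2) N(2)] by simp
    fix A assume A: "A \<in> Ob C"
    have "f = HomZero C A (ShiftO C N)" if "f \<in> Hom C A (ShiftO C N)" for f
      using comp_ident_left[OF that] i0 comp_zero_left[OF that sN] by simp
    thus "\<exists>!f. f \<in> Hom C A (ShiftO C N)" using zero_hom[OF A sN] by blast
    have "f = HomZero C (ShiftO C N) A" if "f \<in> Hom C (ShiftO C N) A" for f
      using comp_ident_right[OF that] i0 comp_zero_right[OF sN that] by simp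
    thus "\<exists>!f. f \<in> Hom C (ShiftO C N) A" using zero_hom[OF sN A] by blast
  qed (rule sN)
  have shape: "triangle_shape C N B B (HomZero C N B) (Ident C B) (HomZero C B (ShiftO C N))"
    unfolding triangle_shape_def using zero_hom ident_hom B N(2) sN by blast
  have "HomNeg C (ShiftA C (HomZero C N B)) = HomZero C (ShiftO C N) (ShiftO C B)"
    using shift.map_zero[OF N(2) B] neg_zero[OF sN shift.map_ob[OF B]] by simp
  hence "dist_triangle C N B B (HomZero C N B) (Ident C B) (HomZero C B (ShiftO C N))"
    using tri_rotate[OF shape] tri_ident[OF B zsN] by simp
  moreover have "u \<odot> f = HomZero C N B \<odot> HomZero C X N"
    using z comp_zero_left[OF zero_hom[OF D(4) N(2)] B] by simp
  ultimately obtain c where "c \<in> Hom C Z B" "c \<odot> g = Ident C B \<odot> u"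
    using tri_morphism[OF t _ zero_hom[OF D(4) N(2)] u] by blast
  thus ?thesis using comp_ident_left[OF u] by auto
qed

lemma contra_exact_right:
  assumes t: "dist_triangle C X Y Z f g h" and v: "v \<in> Hom C Z B"
    and z: "v \<odot> g = HomZero C Y B"
  shows "\<exists>w \<in> Hom C (ShiftO C X) B. w \<odot> h = v"
  by (rule contra_exact_middle[OF tri_rot[OF t] v z])

text \<open>The rotated triangle yields an extension of the translate of \<open>u\<close>, and full
  faithfulness of the translation brings it back down.\<close>

lemma contra_exact_left:
  assumes t: "dist_triangle C X Y Z f g h" and u: "u \<in> Hom C X B"
    and z: "ShiftA C u \<odot> h = HomZero C Z (ShiftO C B)"
  shows "\<exists>v \<in> Hom C Y B. v \<odot> f = u"
proof -
  note D = dist_triangleD[OF t]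
  note B = hom_cod[OF u]
  obtain w where w: "w \<in> Hom C (ShiftO C Y) (ShiftO C B)"
      "w \<odot> HomNeg C (ShiftA C f) = ShiftA C u"
    using contra_exact_right[OF tri_rot[OF t] shift.map_hom[OF u] z] by blast
  obtain v where v: "v \<in> Hom C Y B" "ShiftA C v = w"
    using shift_surj[OF D(5) B w(1)] .
  note vf = comp_hom[OF D(1) v(1)]
  \<comment> \<open>The sign introduced by rotation is absorbed by taking \<open>HomNeg C v\<close>
    as the extension.\<close>
  have "ShiftA C (HomNeg C v \<odot> f) = ShiftA C u"
    using comp_neg_left[OF D(1) v(1)] shift.map_neg[OF vf] shift.map_comp[OF D(1) v(1)] v(2) w(2)
      comp_neg_right[OF shift.map_hom[OF D(1)] w(1)] by simp
  hence "HomNeg C v \<odot> f = u"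
    by (rule shift_inj[OF comp_hom[OF D(1) neg_hom[OF v(1)]] u])
  thus ?thesis using neg_hom[OF v(1)] by blast
qed

text \<open>From the rotated trivial triangle
  \<open>A \<rightarrow> N \<rightarrow> \<Sigma> A\<close>, the arrows \<open>u\<close> and zero
  extend to a morphism of triangles whose third component is \<open>w\<close> up to sign.\<close>

lemma cov_exact_left:
  assumes t: "dist_triangle C X Y Z f g h" and u: "u \<in> Hom C A X"
    and z: "f \<odot> u = HomZero C A Y"
  shows "\<exists>w \<in> Hom C (ShiftO C A) Z. h \<odot> w = ShiftA C u"
proof -
  note D = dist_triangleD[OF t]
  note A = hom_dom[OF u] and su = shift.map_hom[OF u]
  note sA = shift.map_ob[OF A]
  obtain N where N: "zero_object C N" "N \<in> Ob C" by (rule zero_object_obtain)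
  note r = tri_rot[OF tri_ident[OF A N(1)]]
  have "HomZero C N Y \<odot> HomZero C A N = f \<odot> u"
    using z comp_zero_left[OF zero_hom[OF A N(2)] D(5)] by simp
  then obtain c where c: "c \<in> Hom C (ShiftO C A) Z"
      "ShiftA C u \<odot> HomNeg C (ShiftA C (Ident C A)) = h \<odot> c"
    using tri_morphism[OF r t u zero_hom[OF N(2) D(5)]] by blast
  have "h \<odot> HomNeg C c = ShiftA C u"
    using comp_neg_right[OF c(1) D(3)] c(2) shift.map_ident[OF A]
      comp_neg_right[OF ident_hom[OF sA] su] comp_ident_right[OF su] neg_neg[OF su] by simp
  thus ?thesis using neg_hom[OF c(1)] by blast
qed

text \<open>An instance of \<open>cov_exact_left\<close> for the rotated triangle, which starts with
  \<open>g\<close>; the resulting arrow between translates is brought back by fullness of the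
  translation.\<close>

lemma cov_exact_middle:
  assumes t: "dist_triangle C X Y Z f g h" and a: "a \<in> Hom C A Y"
    and z: "g \<odot> a = HomZero C A Z"
  shows "\<exists>u \<in> Hom C A X. f \<odot> u = a"
proof -
  note D = dist_triangleD[OF t]
  note A = hom_dom[OF a]
  obtain w where w: "w \<in> Hom C (ShiftO C A) (ShiftO C X)"
      "HomNeg C (ShiftA C f) \<odot> w = ShiftA C a"
    using cov_exact_left[OF tri_rot[OF t] a z] by blast
  obtain v where v: "v \<in> Hom C A X" "ShiftA C v = w"
    using shift_surj[OF A D(4) w(1)] .
  have "ShiftA C (f \<odot> HomNeg C v) = ShiftA C a"
    using comp_neg_right[OF v(1) D(1)] shift.map_neg[OF comp_hom[OF v(1) D(1)]]
      shift.map_comp[OF v(1) D(1)] v(2) w(2) comp_neg_left[OF w(1) shift.map_hom[OF D(1)]] by simp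
  hence "f \<odot> HomNeg C v = a"
    by (rule shift_inj[OF comp_hom[OF neg_hom[OF v(1)] D(1)] a])
  thus ?thesis using neg_hom[OF v(1)] by blast
qed

text \<open>The two vanishing hom-sets flank this map in the long exact sequence of
  \<open>Hom(-, B)\<close>: the first gives injectivity, the second surjectivity.\<close>

lemma tri_precomp_fst_bij:
  assumes t: "dist_triangle C X Y Z f g h" and B: "B \<in> Ob C"
    and z: "Hom C Z B = {HomZero C Z B}"
    and zs: "Hom C Z (ShiftO C B) = {HomZero C Z (ShiftO C B)}"
  shows "bij_betw (\<lambda>u. u \<odot> f) (Hom C Y B) (Hom C X B)"
proof (rule precomp_bijI)
  note D = dist_triangleD[OF t]
  show "f \<in> Hom C X Y" by (rule D(1))
  show "u = HomZero C Y B" if u: "u \<in> Hom C Y B" "u \<odot> f = HomZero C X B" for u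
    using contra_exact_middle[OF t u] z comp_zero_left[OF D(2) B] by auto
  show "\<exists>u \<in> Hom C Y B. u \<odot> f = v" if v: "v \<in> Hom C X B" for v
    by (rule contra_exact_left[OF t v hom_zero_eqI[OF zs comp_hom[OF D(3) shift.map_hom[OF v]]]])
qed

lemma tri_precomp_snd_bij:
  assumes t: "dist_triangle C X Y Z f g h" and B: "B \<in> Ob C"
    and z: "Hom C X B = {HomZero C X B}"
    and zs: "Hom C (ShiftO C X) B = {HomZero C (ShiftO C X) B}"
  shows "bij_betw (\<lambda>u. u \<odot> g) (Hom C Z B) (Hom C Y B)"
  using tri_precomp_fst_bij[OF tri_rot[OF t] B zs] shift_hom_zero_iff[OF dist_triangleD(4)[OF t] B] z
  by blast

text \<open>In the sequence of \<open>Hom(A, -)\<close> the roles are exchanged: the second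
  vanishing gives injectivity, the first surjectivity.\<close>

lemma tri_postcomp_fst_bij:
  assumes t: "dist_triangle C X Y Z f g h" and A: "A \<in> Ob C"
    and z: "Hom C A Z = {HomZero C A Z}"
    and zs: "Hom C (ShiftO C A) Z = {HomZero C (ShiftO C A) Z}"
  shows "bij_betw (\<lambda>u. f \<odot> u) (Hom C A X) (Hom C A Y)"
proof (rule postcomp_bijI)
  note D = dist_triangleD[OF t]
  show "f \<in> Hom C X Y" by (rule D(1))
  show "u = HomZero C A X" if u: "u \<in> Hom C A X" "f \<odot> u = HomZero C A Y" for u
  proof (rule shift_inj[OF u(1) zero_hom[OF A D(4)]])
    show "ShiftA C u = ShiftA C (HomZero C A X)"
      using cov_exact_left[OF t u] zs comp_zero_right[OF shift.map_ob[OF A] D(3)]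
        shift.map_zero[OF A D(4)] by auto
  qed
  show "\<exists>u \<in> Hom C A X. f \<odot> u = v" if v: "v \<in> Hom C A Y" for v
    by (rule cov_exact_middle[OF t v hom_zero_eqI[OF z comp_hom[OF v D(2)]]])
qed

section \<open>Uniqueness of cones\<close>

lemma cone_endo_unit:
  assumes t: "dist_triangle C X Y Z f g h" and e: "e \<in> Hom C Z Z"
    and eg: "e \<odot> g = g" and he: "h \<odot> e = h"
  shows "\<exists>k \<in> Hom C Z Z. k \<odot> e = Ident C Z \<and> e \<odot> k = Ident C Z"
proof -
  note D = dist_triangleD[OF t]
  note i = ident_hom[OF D(6)]
  obtain d where d: "d \<in> Hom C Z Z" "HomAdd C d (Ident C Z) = e"
    using hom_diff[OF e i] .
  have "d \<odot> g = HomZero C Y Z"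
    by (rule add_eq_self[OF comp_hom[OF D(2) d(1)] D(2)])
      (use comp_add_left[OF D(2) d(1) i] d(2) eg comp_ident_left[OF D(2)] in simp)
  then obtain w where w: "w \<in> Hom C (ShiftO C X) Z" "w \<odot> h = d"
    using contra_exact_right[OF t d(1)] by blast
  have hd: "h \<odot> d = HomZero C Z (ShiftO C X)"
    by (rule add_eq_self[OF comp_hom[OF d(1) D(3)] D(3)])
      (use comp_add_right[OF d(1) i D(3)] d(2) he comp_ident_right[OF D(3)] in simp)
  have "d \<odot> d = HomZero C Z Z"
    using comp_assoc[OF d(1) D(3) w(1)] w(2) hd comp_zero_right[OF D(6) w(1)] by simp
  from square_zero_unit[OF d(1) this] show ?thesis using d(2) by simp
qed

text \<open>The composites \<open>e\<close> of the comparison maps between the two cones are invertible: \<open>e\<close> differs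
  from the identity by a map that factors as \<open>w \<odot> h\<close> and is killed by \<open>h\<close>, hence squares to
  zero.\<close>

lemma cone_unique:
  assumes t: "dist_triangle C X Y Z f g h" and t': "dist_triangle C X Y Z' f g' h'"
  shows "iso_objs C Z Z'"
proof -
  note D = dist_triangleD[OF t] and D' = dist_triangleD[OF t']
  note iX = ident_hom[OF D(4)] and iY = ident_hom[OF D(5)]
  have sq: "Ident C Y \<odot> f = f \<odot> Ident C X"
    using comp_ident_left[OF D(1)] comp_ident_right[OF D(1)] by simp
  obtain c where c: "c \<in> Hom C Z Z'" "c \<odot> g = g'" "h' \<odot> c = h"
    using tri_morphism[OF t t' iX iY sq] comp_ident_right[OF D'(2)]
      shift.map_ident[OF D(4)] comp_ident_left[OF D(3)] by auto
  obtain b where b: "b \<in> Hom C Z' Z" "b \<odot> g' = g" "h \<odot> b = h'"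
    using tri_morphism[OF t' t iX iY sq] comp_ident_right[OF D(2)]
      shift.map_ident[OF D(4)] comp_ident_left[OF D'(3)] by auto
  note bc = comp_hom[OF c(1) b(1)] and cb = comp_hom[OF b(1) c(1)]
  obtain k where k: "k \<in> Hom C Z Z" "k \<odot> (b \<odot> c) = Ident C Z"
    using cone_endo_unit[OF t bc] comp_assoc[OF D(2) c(1) b(1)] comp_assoc[OF c(1) b(1) D(3)] b c
    by auto
  obtain l where l: "l \<in> Hom C Z' Z'" "(c \<odot> b) \<odot> l = Ident C Z'"
    using cone_endo_unit[OF t' cb] comp_assoc[OF D'(2) b(1) c(1)] comp_assoc[OF b(1) c(1) D'(3)] b c
    by auto
  note kb = comp_hom[OF b(1) k(1)] and bl = comp_hom[OF l(1) b(1)]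
  have left: "(k \<odot> b) \<odot> c = Ident C Z"
    using comp_assoc[OF c(1) b(1) k(1)] k(2) by simp
  have right: "c \<odot> (b \<odot> l) = Ident C Z'"
    using comp_assoc[OF l(1) b(1) c(1)] l(2) by simp
  \<comment> \<open>A left and a right inverse of \<open>c\<close> agree: insert \<open>c\<close>
    between them.\<close>
  have "k \<odot> b = b \<odot> l"
    using comp_assoc[OF bl c(1) kb] left right comp_ident_left[OF bl] comp_ident_right[OF kb]
    by simp
  thus ?thesis
    unfolding iso_objs_def iso_arr_def using c(1) kb left right by auto
qed

text \<open>Transport along \<open>a\<close> and \<open>b\<close> turns the first triangle into one
  on \<open>f'\<close> with the same third vertex \<open>Z\<close>; then two cones of
  \<open>f'\<close> are compared.\<close>

lemma cone_iso:
  assumes t: "dist_triangle C X Y Z f g h" and t': "dist_triangle C X' Y' Z' f' g' h'"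
    and a: "iso_arr C X X' a" and b: "iso_arr C Y Y' b" and sq: "b \<odot> f = f' \<odot> a"
  shows "iso_objs C Z Z'"
proof -
  note D = dist_triangleD[OF t] and D' = dist_triangleD[OF t']
  obtain b' where b': "iso_arr C Y' Y b'" "b' \<odot> b = Ident C Y" "b \<odot> b' = Ident C Y'"
    using b by (rule iso_arr_inverse)
  note ah = iso_arr_hom[OF a] and bh = iso_arr_hom[OF b] and bh' = iso_arr_hom[OF b'(1)]
  note sa = shift.map_hom[OF ah]
  note gb = comp_hom[OF bh' D(2)] and ah' = comp_hom[OF D(3) sa]
  have "dist_triangle C X' Y' Z f' (g \<odot> b') (ShiftA C a \<odot> h)"
  proof (rule tri_iso[OF t _ a b iso_arr_ident[OF D(6)] sq])
    show "triangle_shape C X' Y' Z f' (g \<odot> b') (ShiftA C a \<odot> h)"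
      unfolding triangle_shape_def using D'(1) gb ah' by blast
    show "Ident C Z \<odot> g = (g \<odot> b') \<odot> b"
      using comp_ident_left[OF D(2)] comp_assoc[OF bh bh' D(2)] b'(2) comp_ident_right[OF D(2)]
      by simp
    show "ShiftA C a \<odot> h = (ShiftA C a \<odot> h) \<odot> Ident C Z"
      using comp_ident_right[OF ah'] by simp
  qed
  thus ?thesis using cone_unique t' by blast
qed

end

section \<open>Stable t-structures\<close>

context triangulated_category
begin

text \<open>\<open>shift_stable\<close> compares closures under isomorphism, so a translate of an
  object of \<open>U\<close> is only isomorphic to an object of \<open>U\<close>.\<close>

lemma shift_stable_iso:
  assumes S: "shift_stable C U" and U: "U \<subseteq> Ob C" and A: "A \<in> U"
  obtains A' e where "A' \<in> U" "iso_arr C (ShiftO C A) A' e"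
proof -
  have "ShiftO C A \<in> Ob C" using U A shift.map_ob by blast
  hence "ShiftO C A \<in> iso_closure C (ShiftO C ` U)"
    using iso_objs_refl A by (auto simp: iso_closure_def)
  hence "ShiftO C A \<in> iso_closure C U"
    using S by (simp add: shift_stable_def)
  thus thesis using that by (auto simp: iso_closure_def iso_objs_def)
qed

lemma stable_t_structure_shift_iso:
  assumes S: "stable_t_structure C U V"
  shows "A \<in> U \<Longrightarrow> \<exists>A' \<in> U. \<exists>e. iso_arr C (ShiftO C A) A' e"
    and "B \<in> V \<Longrightarrow> \<exists>B' \<in> V. \<exists>e. iso_arr C (ShiftO C B) B' e"
  using S shift_stable_iso unfolding stable_t_structure_def by metis+

text \<open>Translates are isomorphic to objects of the same half, so orthogonality carries over.
  The translated versions are the flanking terms of the long exact sequences.\<close>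

lemma stable_t_structure_zero:
  assumes S: "stable_t_structure C U V" and A: "A \<in> U" and B: "B \<in> V"
  shows "Hom C A B = {HomZero C A B}"
    and "Hom C (ShiftO C A) B = {HomZero C (ShiftO C A) B}"
    and "Hom C A (ShiftO C B) = {HomZero C A (ShiftO C B)}"
proof -
  have z: "Hom C X Y = {HomZero C X Y}" if "X \<in> U" "Y \<in> V" for X Y
    using S that by (simp add: stable_t_structure_def)
  have ob: "A \<in> Ob C" "B \<in> Ob C"
    using S A B by (auto simp: stable_t_structure_def)
  show "Hom C A B = {HomZero C A B}" using z A B .
  obtain A' e where A': "A' \<in> U" and e: "iso_arr C (ShiftO C A) A' e"
    using stable_t_structure_shift_iso(1)[OF S A] by blast
  show "Hom C (ShiftO C A) B = {HomZero C (ShiftO C A) B}"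
    by (rule hom_zero_iso_dom[OF e ob(2) z[OF A' B]])
  obtain B' d where B': "B' \<in> V" and d: "iso_arr C (ShiftO C B) B' d"
    using stable_t_structure_shift_iso(2)[OF S B] by blast
  obtain d' where "iso_arr C B' (ShiftO C B) d'"
    using d by (rule iso_arr_inverse)
  thus "Hom C A (ShiftO C B) = {HomZero C A (ShiftO C B)}"
    using hom_zero_iso_cod ob(1) z[OF A B'] by blast
qed

lemma stable_t_structureE:
  assumes "stable_t_structure C U V" "X \<in> Ob C"
  obtains A B f g h where "A \<in> U" "B \<in> V" "dist_triangle C A X B f g h"
  using assms unfolding stable_t_structure_def by blast

lemma stable_t_structure_ob:
  assumes "stable_t_structure C U V"
  shows "A \<in> U \<Longrightarrow> A \<in> Ob C" "B \<in> V \<Longrightarrow> B \<in> Ob C"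
  using assms by (auto simp: stable_t_structure_def)

text \<open>Objects of \<open>V\<close> do not see \<open>f\<close>, because its cone lies in
  \<open>U\<close>.\<close>

lemma t_precomp_fst_bij:
  assumes S: "stable_t_structure C U V" and t: "dist_triangle C X Y Z f g h"
    and Z: "Z \<in> U" and B: "B \<in> V"
  shows "bij_betw (\<lambda>u. u \<odot> f) (Hom C Y B) (Hom C X B)"
  using tri_precomp_fst_bij[OF t stable_t_structure_ob(2)[OF S B]] stable_t_structure_zero[OF S Z B]
  by blast

text \<open>When \<open>Z\<close> lies in \<open>V\<close>, this makes \<open>g\<close> the
  reflection of \<open>Y\<close> into \<open>V\<close>.\<close>

lemma t_precomp_snd_bij:
  assumes S: "stable_t_structure C U V" and t: "dist_triangle C X Y Z f g h"
    and X: "X \<in> U" and B: "B \<in> V"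
  shows "bij_betw (\<lambda>u. u \<odot> g) (Hom C Z B) (Hom C Y B)"
  using tri_precomp_snd_bij[OF t stable_t_structure_ob(2)[OF S B]] stable_t_structure_zero[OF S X B]
  by blast

text \<open>When \<open>X\<close> lies in \<open>U\<close>, this makes \<open>f\<close> the
  coreflection of \<open>Y\<close> into \<open>U\<close>.\<close>

lemma t_postcomp_fst_bij:
  assumes S: "stable_t_structure C U V" and t: "dist_triangle C X Y Z f g h"
    and A: "A \<in> U" and Z: "Z \<in> V"
  shows "bij_betw (\<lambda>u. f \<odot> u) (Hom C A X) (Hom C A Y)"
  using tri_postcomp_fst_bij[OF t stable_t_structure_ob(1)[OF S A]] stable_t_structure_zero[OF S A Z]
  by blast

end

section \<open>Triangle functors compatible with stable t-structures\<close>

lemma full_subcat_simps: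
  "Ob (full_subcat C U) = U" "Ident (full_subcat C U) = Ident C"
  "Comp (full_subcat C U) = Comp C"
  "Hom (full_subcat C U) X Y = (if X \<in> U \<and> Y \<in> U then Hom C X Y else {})"
  by (auto simp: full_subcat_def Hom_def)

section \<open>Functors restricted to full subcategories\<close>

context cat_functor
begin

text \<open>Phrased through hom-sets of the ambient categories, where the approximating triangles
  live.\<close>

definition ff_on :: "'o1 set \<Rightarrow> bool"
  where "ff_on U \<longleftrightarrow> (\<forall>X \<in> U. \<forall>Y \<in> U. ff_at X Y)"

definition ess_surj_on :: "'o1 set \<Rightarrow> 'o2 set \<Rightarrow> bool"
  where "ess_surj_on U U' \<longleftrightarrow> (\<forall>Y \<in> U'. \<exists>X \<in> U. iso_objs D (Fo X) Y)"

lemma fully_faithful_full_subcat_imp_ff_on: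
  assumes "fully_faithful (full_subcat C U) (full_subcat D U') Fo Fa"
  shows "ff_on U"
proof -
  interpret S: cat_functor "full_subcat C U" "full_subcat D U'" Fo Fa
    using assms by (simp add: fully_faithful_def)
  have m: "Fo X \<in> U'" if "X \<in> U" for X
    using S.map_ob[of X] that by (simp add: full_subcat_simps)
  show ?thesis
    using assms m by (simp add: ff_on_def ff_at_def fully_faithful_def full_subcat_simps)
qed

lemma equivalence_full_subcat_imp:
  assumes "cat_equivalence (full_subcat C U) (full_subcat D U') Fo Fa"
  shows "ff_on U" "ess_surj_on U U'"
proof -
  interpret S: cat_functor "full_subcat C U" "full_subcat D U'" Fo Fa
    using assms by (simp add: cat_equivalence_def)
  show "ff_on U"
    using S.equivalence_imp_ff_ess_surj(1)[OF assms] by (rule fully_faithful_full_subcat_imp_ff_on)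
  have "iso_objs D X Y" if "iso_objs (full_subcat D U') X Y" for X Y
    using that by (auto simp: iso_objs_def iso_arr_def full_subcat_simps split: if_splits)
  thus "ess_surj_on U U'"
    using S.equivalence_imp_ff_ess_surj(2)[OF assms]
    unfolding ess_surj_on_def essentially_surjective_def full_subcat_simps by blast
qed

end

section \<open>Transfer of full faithfulness and essential surjectivity\<close>

context triangle_functor
begin

lemma \<phi>_iso: "X \<in> Ob C \<Longrightarrow> iso_arr D (Fo (ShiftO C X)) (ShiftO D (Fo X)) (\<phi> X)"
  using shift_compat by (simp add: natural_iso_def)

lemma \<phi>_natural:
  "f \<in> Hom C X Y \<Longrightarrow> \<phi> Y \<odot>\<^bsub>D\<^esub> Fa (ShiftA C f) = ShiftA D (Fa f) \<odot>\<^bsub>D\<^esub> \<phi> X"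
  using shift_compat C.hom_dom C.hom_cod by (fastforce simp: natural_iso_def)

text \<open>\<open>Fo\<close> respects both halves, so the image triangle has the same
  precomposition bijection, and \<open>ff_at_precomp\<close> compares the two.\<close>

lemma ff_at_t_precomp_fst:
  assumes S: "stable_t_structure C U V" "stable_t_structure D U' V'"
    and F: "Fo ` U \<subseteq> U'" "Fo ` V \<subseteq> V'"
    and t: "dist_triangle C X Y Z f g h" and Z: "Z \<in> U" and B: "B \<in> V"
  shows "ff_at Y B \<longleftrightarrow> ff_at X B"
  using ff_at_precomp[OF C.dist_triangleD(1)[OF t] C.t_precomp_fst_bij[OF S(1) t Z B]
      D.t_precomp_fst_bij[OF S(2) map_triangle[OF t]]] F Z B
  by blast

lemma ff_at_t_postcomp_fst:
  assumes S: "stable_t_structure C U V" "stable_t_structure D U' V'"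
    and F: "Fo ` U \<subseteq> U'" "Fo ` V \<subseteq> V'"
    and t: "dist_triangle C X Y Z f g h" and A: "A \<in> U" and Z: "Z \<in> V"
  shows "ff_at A X \<longleftrightarrow> ff_at A Y"
  using ff_at_postcomp[OF C.dist_triangleD(1)[OF t] C.t_postcomp_fst_bij[OF S(1) t A Z]
      D.t_postcomp_fst_bij[OF S(2) map_triangle[OF t]]] F Z A
  by blast

text \<open>Replacing \<open>Y\<close> by its coreflection \<open>K\<close> in \<open>U\<close>
  changes the arrows from \<open>A\<close> neither before nor after applying the functor.\<close>

lemma ff_at_left_part:
  assumes S: "stable_t_structure C U V" "stable_t_structure D U' V'"
    and F: "Fo ` U \<subseteq> U'" "Fo ` V \<subseteq> V'"
    and ff: "ff_on U" and A: "A \<in> U" and Y: "Y \<in> Ob C"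
  shows "ff_at A Y"
proof -
  obtain K B f g h where K: "K \<in> U" and B: "B \<in> V" and t: "dist_triangle C K Y B f g h"
    using C.stable_t_structureE[OF S(1) Y] .
  have "ff_at A K" using ff A K by (simp add: ff_on_def)
  thus ?thesis using ff_at_t_postcomp_fst[OF S F t A B] by simp
qed

text \<open>The approximation \<open>A \<rightarrow> X\<close> has its cone in \<open>V\<close>,
  invisible to \<open>Y\<close> in \<open>W\<close>. The question moves to \<open>A\<close> and
  \<open>Y\<close>, where \<open>ff_at_left_part\<close> answers it.\<close>

lemma ff_on_next_but_one:
  assumes UV: "stable_t_structure C U V" "stable_t_structure D U' V'"
    and VW: "stable_t_structure C V W" "stable_t_structure D V' W'"
    and F: "Fo ` U \<subseteq> U'" "Fo ` V \<subseteq> V'" "Fo ` W \<subseteq> W'"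
    and ff: "ff_on U"
  shows "ff_on W"
  unfolding ff_on_def
proof (intro ballI)
  fix X Y assume X: "X \<in> W" and Y: "Y \<in> W"
  note ob = C.stable_t_structure_ob(2)[OF VW(1)]
  obtain A B f g h where A: "A \<in> U" and B: "B \<in> V" and t: "dist_triangle C A X B f g h"
    using C.stable_t_structureE[OF UV(1) ob[OF X]] .
  have "ff_at A Y"
    by (rule ff_at_left_part[OF UV F(1,2) ff A ob[OF Y]])
  thus "ff_at X Y"
    using ff_at_t_precomp_fst[OF VW F(2,3) t B Y] by simp
qed

text \<open>For \<open>A\<close> in \<open>U\<close>, the triangles of the two stable t-structures exhibit both an object of
  \<open>W'\<close> and \<open>Fo\<close> of an object of \<open>W\<close> as reflections of \<open>Fo A\<close> into \<open>W'\<close>.\<close>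

lemma ess_surj_on_next_but_one:
  assumes UV: "stable_t_structure C U V" "stable_t_structure D U' V'"
    and VW: "stable_t_structure C V W" "stable_t_structure D V' W'"
    and F: "Fo ` U \<subseteq> U'" "Fo ` V \<subseteq> V'" "Fo ` W \<subseteq> W'"
    and es: "ess_surj_on U U'"
  shows "ess_surj_on W W'"
  unfolding ess_surj_on_def
proof
  fix Y assume Y: "Y \<in> W'"
  obtain A' B' f' g' h' where A': "A' \<in> U'" and B': "B' \<in> V'"
    and t': "dist_triangle D A' Y B' f' g' h'"
    using D.stable_t_structureE[OF UV(2) D.stable_t_structure_ob(2)[OF VW(2) Y]] .
  obtain A e where A: "A \<in> U" and e: "iso_arr D (Fo A) A' e"
    using es A' unfolding ess_surj_on_def iso_objs_def by blast
  \<comment> \<open>\<open>A\<close> is decomposed along \<open>(V, W)\<close>: its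
    \<open>W\<close>-part \<open>X\<close> will be the preimage of \<open>Y\<close> up to
    isomorphism.\<close>
  obtain K X f g h where K: "K \<in> V" and X: "X \<in> W" and t: "dist_triangle C K A X f g h"
    using C.stable_t_structureE[OF VW(1) C.stable_t_structure_ob(1)[OF UV(1) A]] .
  note Ft = map_triangle[OF t]
  have FK: "Fo K \<in> V'" and FX: "Fo X \<in> W'" using F K X by blast+
  note eh = iso_arr_hom[OF e] and f'h = D.dist_triangleD(1)[OF t']
  have "iso_objs D (Fo X) Y"
  proof (rule D.iso_from_universal[OF D.dist_triangleD(2)[OF Ft] D.comp_hom[OF eh f'h] FX Y])
    fix B assume B: "B \<in> W'"
    show "bij_betw (\<lambda>u. u \<odot>\<^bsub>D\<^esub> Fa g) (Hom D (Fo X) B) (Hom D (Fo A) B)"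
      by (rule D.t_precomp_snd_bij[OF VW(2) Ft FK B])
    \<comment> \<open>Arrows into \<open>B\<close> see neither the isomorphism \<open>e\<close> nor
      \<open>f'\<close>, whose cone \<open>B'\<close> lies in \<open>V'\<close>.\<close>
    have "bij_betw ((\<lambda>u. u \<odot>\<^bsub>D\<^esub> e) \<circ> (\<lambda>u. u \<odot>\<^bsub>D\<^esub> f')) (Hom D Y B) (Hom D (Fo A) B)"
      by (rule bij_betw_trans[OF D.t_precomp_fst_bij[OF VW(2) t' B' B] D.iso_precomp_bij[OF e]])
    thus "bij_betw (\<lambda>u. u \<odot>\<^bsub>D\<^esub> f' \<odot>\<^bsub>D\<^esub> e) (Hom D Y B) (Hom D (Fo A) B)"
      by (rule bij_betw_cong[THEN iffD1, rotated]) (simp add: D.comp_assoc[OF eh f'h])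
  qed
  thus "\<exists>X \<in> W. iso_objs D (Fo X) Y" using X by blast
qed

text \<open>The five lemma as a diagram chase. At the ends only half is used: surjectivity on arrows
  from \<open>ShiftO C A\<close> to \<open>Y\<close> for injectivity, injectivity on arrows from
  \<open>B\<close> to \<open>ShiftO C Y\<close> for surjectivity.\<close>

lemma ff_at_extension:
  assumes t: "dist_triangle C A X B f g h" and Y: "Y \<in> Ob C"
    and PA: "ff_at A Y" and PB: "ff_at B Y"
    and PsA: "ff_at (ShiftO C A) Y" and PBs: "ff_at B (ShiftO C Y)"
  shows "ff_at X Y"
proof -
  note H = C.dist_triangleD[OF t]
  note Ft = map_triangle[OF t]
  note FH = D.dist_triangleD[OF Ft]
  note FY = map_ob[OF Y]
  have sA: "ShiftO C A \<in> Ob C" by (rule C.hom_cod[OF H(3)])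
  have sY: "ShiftO C Y \<in> Ob C" using Y by (rule C.shift.map_ob)
  have inj: "u = HomZero C X Y"
    if u: "u \<in> Hom C X Y" and z: "Fa u = HomZero D (Fo X) (Fo Y)" for u
  proof -
    have "Fa (u \<odot>\<^bsub>C\<^esub> f) = Fa (HomZero C A Y)"
      using map_comp[OF H(1) u] z D.comp_zero_left[OF FH(1) FY] map_zero[OF H(4) Y] by simp
    hence "u \<odot>\<^bsub>C\<^esub> f = HomZero C A Y"
      by (rule ff_at_inj[OF PA C.comp_hom[OF H(1) u] C.zero_hom[OF H(4) Y]])
    then obtain v where v: "v \<in> Hom C B Y" "v \<odot>\<^bsub>C\<^esub> g = u"
      using C.contra_exact_middle[OF t u] by blast
    have "Fa v \<odot>\<^bsub>D\<^esub> Fa g = HomZero D (Fo X) (Fo Y)"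
      using map_comp[OF H(2) v(1)] v(2) z by simp
    then obtain w where w: "w \<in> Hom D (ShiftO D (Fo A)) (Fo Y)"
        "w \<odot>\<^bsub>D\<^esub> (\<phi> A \<odot>\<^bsub>D\<^esub> Fa h) = Fa v"
      using D.contra_exact_right[OF Ft map_hom[OF v(1)]] by blast
    note p = iso_arr_hom[OF \<phi>_iso[OF H(4)]]
    \<comment> \<open>Composing with \<open>\<phi> A\<close> makes the source of \<open>w\<close>
      the image of \<open>ShiftO C A\<close>, where \<open>PsA\<close> lifts it.\<close>
    obtain x where x: "x \<in> Hom C (ShiftO C A) Y" "Fa x = w \<odot>\<^bsub>D\<^esub> \<phi> A"
      using ff_at_surj[OF PsA D.comp_hom[OF p w(1)]] .
    have "Fa (x \<odot>\<^bsub>C\<^esub> h) = Fa v"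
      using map_comp[OF H(3) x(1)] x(2) w(2) D.comp_assoc[OF map_hom[OF H(3)] p w(1)] by simp
    hence "x \<odot>\<^bsub>C\<^esub> h = v"
      by (rule ff_at_inj[OF PB C.comp_hom[OF H(3) x(1)] v(1)])
    \<comment> \<open>Now \<open>u\<close> factors through two consecutive maps of a
      triangle.\<close>
    hence "u = x \<odot>\<^bsub>C\<^esub> (h \<odot>\<^bsub>C\<^esub> g)"
      using v(2) C.comp_assoc[OF H(2,3) x(1)] by simp
    thus ?thesis
      using C.tri_comp_zero[OF C.tri_rot[OF t]] C.comp_zero_right[OF H(5) x(1)] by simp
  qed
  have surj: "\<exists>u \<in> Hom C X Y. Fa u = y" if y: "y \<in> Hom D (Fo X) (Fo Y)" for y
  proof -
    note yf = D.comp_hom[OF FH(1) y]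
    obtain u where u: "u \<in> Hom C A Y" "Fa u = y \<odot>\<^bsub>D\<^esub> Fa f"
      using ff_at_surj[OF PA yf] .
    note su = C.shift.map_hom[OF u(1)]
    note p = iso_arr_hom[OF \<phi>_iso[OF H(4)]] and q = iso_arr_hom[OF \<phi>_iso[OF Y]]
    note suh = C.comp_hom[OF H(3) su] and Fh = map_hom[OF H(3)]
    \<comment> \<open>\<open>ShiftA C u \<odot> h\<close> obstructs extending \<open>u\<close> along
      \<open>f\<close>. Its image vanishes because \<open>Fa u\<close> does extend, namely to
      \<open>y\<close>; composing with \<open>\<phi> Y\<close> lets the translation of
      \<open>D\<close> act on this.\<close>
    have "\<phi> Y \<odot>\<^bsub>D\<^esub> Fa (ShiftA C u \<odot>\<^bsub>C\<^esub> h) = (\<phi> Y \<odot>\<^bsub>D\<^esub> Fa (ShiftA C u)) \<odot>\<^bsub>D\<^esub> Fa h"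
      using map_comp[OF H(3) su] D.comp_assoc[OF Fh map_hom[OF su] q] by simp
    also have "\<dots> = ShiftA D (Fa u) \<odot>\<^bsub>D\<^esub> (\<phi> A \<odot>\<^bsub>D\<^esub> Fa h)"
      using \<phi>_natural[OF u(1)] D.comp_assoc[OF Fh p D.shift.map_hom[OF map_hom[OF u(1)]]] by simp
    also have "\<dots> = ShiftA D y \<odot>\<^bsub>D\<^esub> (ShiftA D (Fa f) \<odot>\<^bsub>D\<^esub> (\<phi> A \<odot>\<^bsub>D\<^esub> Fa h))"
      using u(2) D.shift.map_comp[OF FH(1) y]
        D.comp_assoc[OF FH(3) D.shift.map_hom[OF FH(1)] D.shift.map_hom[OF y]] by simp
    also have "\<dots> = HomZero D (Fo B) (ShiftO D (Fo Y))"
      using D.tri_comp_zero'[OF Ft] D.comp_zero_right[OF FH(6) D.shift.map_hom[OF y]] by simp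
    also have "\<dots> = \<phi> Y \<odot>\<^bsub>D\<^esub> Fa (HomZero C B (ShiftO C Y))"
      using map_zero[OF H(6) sY] D.comp_zero_right[OF FH(6) q] by simp
    finally have "Fa (ShiftA C u \<odot>\<^bsub>C\<^esub> h) = Fa (HomZero C B (ShiftO C Y))"
      by (rule D.iso_postcomp_cancel[OF \<phi>_iso[OF Y] map_hom[OF suh]
            map_hom[OF C.zero_hom[OF H(6) sY]]])
    hence "ShiftA C u \<odot>\<^bsub>C\<^esub> h = HomZero C B (ShiftO C Y)"
      by (rule ff_at_inj[OF PBs suh C.zero_hom[OF H(6) sY]])
    then obtain x where x: "x \<in> Hom C X Y" "x \<odot>\<^bsub>C\<^esub> f = u"
      using C.contra_exact_left[OF t u(1)] by blast
    note Fx = map_hom[OF x(1)]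
    \<comment> \<open>\<open>Fa x\<close> and \<open>y\<close> agree so far only after
      \<open>Fa f\<close>; their difference comes from \<open>Fo B\<close>, is lifted there and
      added to \<open>x\<close>.\<close>
    obtain d where d: "d \<in> Hom D (Fo X) (Fo Y)" "HomAdd D d (Fa x) = y"
      using D.hom_diff[OF y Fx] .
    note df = D.comp_hom[OF FH(1) d(1)]
    have "d \<odot>\<^bsub>D\<^esub> Fa f = HomZero D (Fo A) (Fo Y)"
      by (rule D.add_eq_self[OF df yf])
        (use D.comp_add_left[OF FH(1) d(1) Fx] d(2) map_comp[OF H(1) x(1)] x(2) u(2) in simp)
    then obtain v' where v': "v' \<in> Hom D (Fo B) (Fo Y)" "v' \<odot>\<^bsub>D\<^esub> Fa g = d"
      using D.contra_exact_middle[OF Ft d(1)] by blast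
    obtain v where v: "v \<in> Hom C B Y" "Fa v = v'"
      using ff_at_surj[OF PB v'(1)] .
    note vg = C.comp_hom[OF H(2) v(1)]
    have "Fa (HomAdd C (v \<odot>\<^bsub>C\<^esub> g) x) = y"
      using map_add[OF vg x(1)] map_comp[OF H(2) v(1)] v(2) v'(2) d(2) by simp
    thus ?thesis using C.add_hom[OF vg x(1)] by blast
  qed
  have "inj_on Fa (Hom C X Y)"
  proof (rule inj_onI)
    fix u v assume u: "u \<in> Hom C X Y" and v: "v \<in> Hom C X Y" and eq: "Fa u = Fa v"
    obtain d where d: "d \<in> Hom C X Y" "HomAdd C d v = u"
      using C.hom_diff[OF u v] .
    have "Fa d = HomZero D (Fo X) (Fo Y)"
      by (rule D.add_eq_self[OF map_hom[OF d(1)] map_hom[OF v]])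
        (use map_add[OF d(1) v] d(2) eq in simp)
    hence "d = HomZero C X Y" by (rule inj[OF d(1)])
    thus "u = v" using d(2) C.add_zero_left[OF v] by simp
  qed
  thus ?thesis
    unfolding ff_at_def bij_betw_def using surj map_hom by blast
qed

text \<open>Both \<open>U\<close> and \<open>V\<close> are left halves, of \<open>(U, V)\<close> and
  \<open>(V, W)\<close>, so full faithfulness on them extends to arbitrary targets, and the triangle
  of \<open>X\<close> combines the two.\<close>

lemma ff_of_ff_on_two:
  assumes UV: "stable_t_structure C U V" "stable_t_structure D U' V'"
    and VW: "stable_t_structure C V W" "stable_t_structure D V' W'"
    and F: "Fo ` U \<subseteq> U'" "Fo ` V \<subseteq> V'" "Fo ` W \<subseteq> W'"
    and ff: "ff_on U" "ff_on V"
  shows "fully_faithful C D Fo Fa"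
  unfolding fully_faithful_iff_ff_at
proof (intro ballI)
  fix X Y assume X: "X \<in> Ob C" and Y: "Y \<in> Ob C"
  obtain A B f g h where A: "A \<in> U" and B: "B \<in> V" and t: "dist_triangle C A X B f g h"
    using C.stable_t_structureE[OF UV(1) X] .
  note PU = ff_at_left_part[OF UV F(1,2) ff(1)] and PV = ff_at_left_part[OF VW F(2,3) ff(2)]
  obtain A' e where A': "A' \<in> U" and e: "iso_arr C (ShiftO C A) A' e"
    using C.stable_t_structure_shift_iso(1)[OF UV(1) A] by blast
  \<comment> \<open>The translate of \<open>A\<close> need not lie in \<open>U\<close>, but the
    isomorphic \<open>A'\<close> does.\<close>
  have "ff_at (ShiftO C A) Y"
    using ff_at_iso_dom[OF e] PU[OF A' Y] by simp
  thus "ff_at X Y"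
    using ff_at_extension[OF t Y PU[OF A Y] PV[OF B Y] _ PV[OF B C.shift.map_ob[OF Y]]] by blast
qed

lemma ess_surj_of_ess_surj_on_two:
  assumes S: "stable_t_structure C U V" "stable_t_structure D U' V'"
    and ff: "fully_faithful C D Fo Fa" and es: "ess_surj_on U U'" "ess_surj_on V V'"
  shows "essentially_surjective C D Fo"
  unfolding essentially_surjective_def
proof
  fix Y' assume "Y' \<in> Ob D"
  \<comment> \<open>A translate is the right form for a cone: rotating the triangle of
    \<open>Y\<close> twice makes \<open>ShiftO D Y\<close> the third vertex over
    \<open>h\<close>.\<close>
  then obtain Y where Y: "Y \<in> Ob D" and YY': "iso_objs D (ShiftO D Y) Y'"
    using D.shift_ess_surj by (auto simp: essentially_surjective_def)
  obtain A' B' f g h where A': "A' \<in> U'" and B': "B' \<in> V'"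
    and t: "dist_triangle D A' Y B' f g h"
    using D.stable_t_structureE[OF S(2) Y] .
  obtain A a where A: "A \<in> U" and a: "iso_arr D (Fo A) A' a"
    using es(1) A' unfolding ess_surj_on_def iso_objs_def by blast
  obtain B b where B: "B \<in> V" and b: "iso_arr D (Fo B) B' b"
    using es(2) B' unfolding ess_surj_on_def iso_objs_def by blast
  have ob: "A \<in> Ob C" "B \<in> Ob C" "ShiftO C A \<in> Ob C"
    using C.stable_t_structure_ob[OF S(1)] A B C.shift.map_ob by blast+
  let ?c = "ShiftA D a \<odot>\<^bsub>D\<^esub> \<phi> A"
  have c: "iso_arr D (Fo (ShiftO C A)) (ShiftO D A') ?c"
    by (rule D.iso_arr_comp[OF \<phi>_iso[OF ob(1)] D.shift.map_iso[OF a]])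
  \<comment> \<open>\<open>k'\<close> is \<open>h\<close> transported to the image of the functor;
    its equation is the square that \<open>cone_iso\<close> asks for.\<close>
  obtain k' where k': "k' \<in> Hom D (Fo B) (Fo (ShiftO C A))" "?c \<odot>\<^bsub>D\<^esub> k' = h \<odot>\<^bsub>D\<^esub> b"
    using D.iso_postcomp_factor[OF c D.comp_hom[OF iso_arr_hom[OF b] D.dist_triangleD(3)[OF t]]] .
  obtain k where k: "k \<in> Hom C B (ShiftO C A)" "Fa k = k'"
    using ff ob ff_at_surj[OF _ k'(1)] by (auto simp: fully_faithful_iff_ff_at)
  obtain Z p q where Z: "dist_triangle C B (ShiftO C A) Z k p q"
    using C.tri_cone[OF k(1)] by blast
  have "iso_objs D (Fo Z) (ShiftO D Y)"
    using D.cone_iso[OF map_triangle[OF Z] D.tri_rot[OF D.tri_rot[OF t]] b c] k(2) k'(2) by simp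
  hence "iso_objs D (Fo Z) Y'" using YY' by (rule D.iso_objs_trans)
  thus "\<exists>X \<in> Ob C. iso_objs D (Fo X) Y'" using C.dist_triangleD(6)[OF Z] by blast
qed

end

section \<open>Polygons of recollements\<close>

lemma cyclic_succ_range: "i \<in> {1..n} \<Longrightarrow> cyclic_succ n i \<in> {1..n}"
  by (auto simp: cyclic_succ_def Suc_le_eq)

text \<open>Indices start at 1, so addition modulo \<open>n\<close> takes place on
  \<open>t - 1\<close> and the outer \<open>Suc\<close> shifts back.\<close>

lemma cyclic_succ_funpow:
  assumes "t \<in> {1..n}"
  shows "(cyclic_succ n ^^ k) t = Suc ((t - 1 + k) mod n)"
proof (induction k)
  case 0
  show ?case using assms by auto
next
  case (Suc k)
  thus ?case by (simp add: cyclic_succ_def mod_Suc_eq)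
qed

locale ngon_functor = triangle_functor C D Fo Fa \<phi>
  for C :: "('o1, 'm1, 'x) tri_data_scheme" and D :: "('o2, 'm2, 'y) tri_data_scheme"
    and Fo :: "'o1 \<Rightarrow> 'o2" and Fa :: "'m1 \<Rightarrow> 'm2" and \<phi> :: "'o1 \<Rightarrow> 'm2" +
  fixes n :: nat and U :: "nat \<Rightarrow> 'o1 set" and V :: "nat \<Rightarrow> 'o2 set"
  assumes ngon_dom: "ngon_of_recollements C n U"
    and ngon_cod: "ngon_of_recollements D n V"
    and sends: "sends_ngon n Fo U V"
begin

lemma stable_succ:
  assumes "i \<in> {1..n}"
  shows "stable_t_structure C (U i) (U (cyclic_succ n i))"
    and "stable_t_structure D (V i) (V (cyclic_succ n i))"
  using ngon_dom ngon_cod assms by (auto simp: ngon_of_recollements_def)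

lemma sends_sub: "i \<in> {1..n} \<Longrightarrow> Fo ` U i \<subseteq> V i"
  using sends by (auto simp: sends_ngon_def)

text \<open>Three successive indices take the roles of \<open>U\<close>, \<open>V\<close>,
  \<open>W\<close> above; modulo \<open>n\<close> they may coincide.\<close>

lemma consecutive_triple:
  assumes i: "i \<in> {1..n}"
  shows "ff_on (U i) \<Longrightarrow> ff_on (U (cyclic_succ n (cyclic_succ n i)))"
    and "ess_surj_on (U i) (V i) \<Longrightarrow>
      ess_surj_on (U (cyclic_succ n (cyclic_succ n i))) (V (cyclic_succ n (cyclic_succ n i)))"
    and "ff_on (U i) \<Longrightarrow> ff_on (U (cyclic_succ n i)) \<Longrightarrow> fully_faithful C D Fo Fa"
proof -
  note j = cyclic_succ_range[OF i]
  note k = cyclic_succ_range[OF j]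
  note S = stable_succ[OF i] stable_succ[OF j] sends_sub[OF i] sends_sub[OF j] sends_sub[OF k]
  show "ff_on (U i) \<Longrightarrow> ff_on (U (cyclic_succ n (cyclic_succ n i)))"
    by (rule ff_on_next_but_one[OF S])
  show "ess_surj_on (U i) (V i) \<Longrightarrow>
      ess_surj_on (U (cyclic_succ n (cyclic_succ n i))) (V (cyclic_succ n (cyclic_succ n i)))"
    by (rule ess_surj_on_next_but_one[OF S])
  show "ff_on (U i) \<Longrightarrow> ff_on (U (cyclic_succ n i)) \<Longrightarrow> fully_faithful C D Fo Fa"
    by (rule ff_of_ff_on_two[OF S])
qed

lemma equivalence_of_two:
  assumes i: "i \<in> {1..n}"
    and ff: "ff_on (U i)" "ff_on (U (cyclic_succ n i))"
    and es: "ess_surj_on (U i) (V i)" "ess_surj_on (U (cyclic_succ n i)) (V (cyclic_succ n i))"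
  shows "cat_equivalence C D Fo Fa"
  using consecutive_triple(3)[OF i ff] ess_surj_of_ess_surj_on_two[OF stable_succ[OF i] _ es]
  by (simp add: cat_equivalence_iff)

text \<open>An odd \<open>n = 2 m - 1\<close> makes \<open>m\<close> double steps amount to a single step.\<close>

lemma odd_step:
  assumes "odd n" and t: "t \<in> {1..n}"
    and step: "\<And>i. i \<in> {1..n} \<Longrightarrow> P i \<Longrightarrow> P (cyclic_succ n (cyclic_succ n i))"
    and P: "P t"
  shows "P (cyclic_succ n t)"
proof -
  let ?s = "cyclic_succ n"
  have r: "(?s ^^ k) t \<in> {1..n}" for k
    by (induction k) (simp_all only: t funpow.simps comp_apply id_apply cyclic_succ_range)
  have "P ((?s ^^ (2 * k)) t)" for k
    by (induction k) (use P step r in \<open>simp_all del: atLeastAtMost_iff\<close>)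
  moreover obtain m where "Suc n = 2 * m"
    using \<open>odd n\<close> by (metis even_Suc evenE)
  ultimately have "P ((?s ^^ Suc n) t)" by simp
  \<comment> \<open>A full turn, after which the last of the \<open>Suc n\<close> steps starts from
    \<open>t\<close>.\<close>
  moreover have "(?s ^^ n) t = t"
    using cyclic_succ_funpow[OF t, of n] t by auto
  ultimately show ?thesis by simp
qed

end

theorem proposition1p7:
  fixes D1 :: "('o1, 'm1, 'x) tri_data_scheme" and D2 :: "('o2, 'm2, 'y) tri_data_scheme"
    and n :: nat and U :: "nat \<Rightarrow> 'o1 set" and V :: "nat \<Rightarrow> 'o2 set"
    and Fo :: "'o1 \<Rightarrow> 'o2" and Fa :: "'m1 \<Rightarrow> 'm2" and \<phi> :: "'o1 \<Rightarrow> 'm2"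
  assumes "triangulated_category D1" and "triangulated_category D2"
    and "ngon_of_recollements D1 n U" and "ngon_of_recollements D2 n V"
    and "triangle_functor D1 D2 Fo Fa \<phi>"
    and "sends_ngon n Fo U V"
  shows
    "(odd n \<longrightarrow> (\<forall>t \<in> {1..n}.
        (fully_faithful (full_subcat D1 (U t)) (full_subcat D2 (V t)) Fo Fa \<longrightarrow>
          fully_faithful D1 D2 Fo Fa) \<and>
        (cat_equivalence (full_subcat D1 (U t)) (full_subcat D2 (V t)) Fo Fa \<longrightarrow>
          cat_equivalence D1 D2 Fo Fa))) \<and>
     (even n \<longrightarrow> (\<forall>t \<in> {1..n}.
        (fully_faithful (full_subcat D1 (U t)) (full_subcat D2 (V t)) Fo Fa \<and>
         fully_faithful (full_subcat D1 (U (cyclic_succ n t)))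
           (full_subcat D2 (V (cyclic_succ n t))) Fo Fa \<longrightarrow>
          fully_faithful D1 D2 Fo Fa) \<and>
        (cat_equivalence (full_subcat D1 (U t)) (full_subcat D2 (V t)) Fo Fa \<and>
         cat_equivalence (full_subcat D1 (U (cyclic_succ n t)))
           (full_subcat D2 (V (cyclic_succ n t))) Fo Fa \<longrightarrow>
          cat_equivalence D1 D2 Fo Fa)))"
proof -
  interpret ngon_functor D1 D2 Fo Fa \<phi> n U V
    using assms by (intro ngon_functor.intro ngon_functor_axioms.intro)
  note sub = fully_faithful_full_subcat_imp_ff_on equivalence_full_subcat_imp
  \<comment> \<open>For odd \<open>n\<close> the hypothesis at \<open>t\<close> is carried to its
    successor, so both parities end with two neighbouring indices.\<close>
  have odd_ff: "ff_on (U (cyclic_succ n t))" if "odd n" "t \<in> {1..n}" "ff_on (U t)" for t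
    by (rule odd_step[where P = "\<lambda>i. ff_on (U i)", OF that(1,2) consecutive_triple(1) that(3)])
  have odd_es: "ess_surj_on (U (cyclic_succ n t)) (V (cyclic_succ n t))"
    if "odd n" "t \<in> {1..n}" "ess_surj_on (U t) (V t)" for t
    by (rule odd_step[where P = "\<lambda>i. ess_surj_on (U i) (V i)", OF that(1,2) consecutive_triple(2) that(3)])
  show ?thesis
    by (intro conjI impI ballI)
      (blast intro: consecutive_triple(3) equivalence_of_two odd_ff odd_es dest: sub)+
qed

end
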